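(* There is a polynomial-time algorithm that, given a connected graph $G$ on $n$ vertices, outputs a mutual-visibility set of $G$ of size $\Omega\left(\sqrt{n/\overline{D}}\right)$, where $\overline{D} = \frac{2}{n(n-1)} \sum_{\{u,v\}} d(u,v)$ is the average distance in $G$, the sum ranging over all unordered pairs $\{u,v\}$ of distinct vertices of $G$.
   Context: All graphs are finite, undirected, and connected; $d(u,v)$ denotes the number of edges of a shortest $u,v$-path. For $X \subseteq V(G)$, two vertices $x,y$ are $X$-visible if there is a shortest $x,y$-path none of whose internal vertices belongs to $X$. A set $X \subseteq V(G)$ is a mutual-visibility set ($\mu$-set) if every two vertices of $X$ are $X$-visible. *)

theory Defs
  imports
    Complex_Main
    "HOL-Computational_Algebra.Polynomial"
    "Graph_Theory.Graph_Theory"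
begin

section \<open>Mutual-visibility sets\<close>

text \<open>
  A finite simple undirected graph is a symmetric loop-free digraph (locale \<^locale>\<open>pair_graph\<close>);
  every edge is present as two opposite arcs. Paths are lists of distinct vertices.
\<close>

definition path_between :: "'a pair_pre_digraph \<Rightarrow> 'a \<Rightarrow> 'a \<Rightarrow> 'a list \<Rightarrow> bool" where
  "path_between G u v p \<longleftrightarrow> vpath p (with_proj G) \<and> hd p = u \<and> last p = v"

definition gdist :: "'a pair_pre_digraph \<Rightarrow> 'a \<Rightarrow> 'a \<Rightarrow> nat" where
  "gdist G u v = (LEAST k. \<exists>p. path_between G u v p \<and> vwalk_length p = k)"

definition shortest_path_between :: "'a pair_pre_digraph \<Rightarrow> 'a \<Rightarrow> 'a \<Rightarrow> 'a list \<Rightarrow> bool" where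
  "shortest_path_between G u v p \<longleftrightarrow> path_between G u v p \<and> vwalk_length p = gdist G u v"

definition internal_verts :: "'a list \<Rightarrow> 'a set" where
  "internal_verts p = set (butlast (tl p))"

definition visible :: "'a pair_pre_digraph \<Rightarrow> 'a set \<Rightarrow> 'a \<Rightarrow> 'a \<Rightarrow> bool" where
  "visible G X x y \<longleftrightarrow> (\<exists>p. shortest_path_between G x y p \<and> internal_verts p \<inter> X = {})"

definition mutual_visibility_set :: "'a pair_pre_digraph \<Rightarrow> 'a set \<Rightarrow> bool" where
  "mutual_visibility_set G X \<longleftrightarrow>
     X \<subseteq> pverts G \<and> (\<forall>x\<in>X. \<forall>y\<in>X. x \<noteq> y \<longrightarrow> visible G X x y)"

text \<open>Each unordered pair of distinct vertices is represented by its increasing enumeration.\<close>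

definition avg_dist :: "'a::linorder pair_pre_digraph \<Rightarrow> real" where
  "avg_dist G =
     2 / (real (card (pverts G)) * (real (card (pverts G)) - 1)) *
     (\<Sum>(u, v) \<in> {(u, v). u \<in> pverts G \<and> v \<in> pverts G \<and> u < v}. real (gdist G u v))"


section \<open>A random access machine\<close>

text \<open>
  Algorithms are structured programs for a random access machine with registers and an unbounded
  indirectly addressed memory, both holding natural numbers. Every executed command costs one
  step, plus one step for every node of the expressions it evaluates. The only arithmetic is
  addition and truncated subtraction: after \<open>t\<close> steps all numbers have \<open>O(t)\<close> more bits than
  initially, so that this unit-cost measure is polynomially related to Turing machine time.
  Multiplication as a primitive would break this (repeated squaring).
\<close>

datatype expr =
    Const nat
  | Reg nat
  | Mem expr
  | Add expr expr
  | Sub expr expr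

datatype prog =
    Skip
  | Assign nat expr
  | Store expr expr
  | Seq prog prog
  | Cond expr prog prog
  | While expr prog

type_synonym state = "(nat \<Rightarrow> nat) \<times> (nat \<Rightarrow> nat)"

primrec val :: "expr \<Rightarrow> state \<Rightarrow> nat" where
  "val (Const k) s = k"
| "val (Reg i) s = fst s i"
| "val (Mem e) s = snd s (val e s)"
| "val (Add e f) s = val e s + val f s"
| "val (Sub e f) s = val e s - val f s"

primrec cost :: "expr \<Rightarrow> nat" where
  "cost (Const k) = 1"
| "cost (Reg i) = 1"
| "cost (Mem e) = 1 + cost e"
| "cost (Add e f) = 1 + cost e + cost f"
| "cost (Sub e f) = 1 + cost e + cost f"

text \<open>
  \<open>exec P s t s'\<close>: program \<open>P\<close> started in state \<open>s\<close> halts in state \<open>s'\<close> after exactly \<open>t\<close> steps.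
  Conditions count as true iff they are nonzero.
\<close>

inductive exec :: "prog \<Rightarrow> state \<Rightarrow> nat \<Rightarrow> state \<Rightarrow> bool" where
  Skip: "exec Skip s 1 s"
| Assign: "exec (Assign i e) s (1 + cost e) ((fst s)(i := val e s), snd s)"
| Store: "exec (Store a e) s (1 + cost a + cost e) (fst s, (snd s)(val a s := val e s))"
| Seq: "exec P s t s' \<Longrightarrow> exec Q s' u s'' \<Longrightarrow> exec (Seq P Q) s (t + u) s''"
| Cond_true: "val e s \<noteq> 0 \<Longrightarrow> exec P s t s' \<Longrightarrow> exec (Cond e P Q) s (1 + cost e + t) s'"
| Cond_false: "val e s = 0 \<Longrightarrow> exec Q s t s' \<Longrightarrow> exec (Cond e P Q) s (1 + cost e + t) s'"
| While_false: "val e s = 0 \<Longrightarrow> exec (While e P) s (1 + cost e) s"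
| While_true: "val e s \<noteq> 0 \<Longrightarrow> exec P s t s' \<Longrightarrow> exec (While e P) s' u s'' \<Longrightarrow>
    exec (While e P) s (1 + cost e + t + u) s''"

inductive_cases SkipE: "exec Skip s t s'"
inductive_cases AssignE: "exec (Assign i e) s t s'"
inductive_cases StoreE: "exec (Store a e) s t s'"
inductive_cases SeqE: "exec (Seq P Q) s t s'"
inductive_cases CondE: "exec (Cond e P Q) s t s'"
inductive_cases WhileE: "exec (While e P) s t s'"

lemma exec_deterministic:
  "exec P s t s' \<Longrightarrow> exec P s u s'' \<Longrightarrow> t = u \<and> s' = s''"
proof (induction arbitrary: u s'' rule: exec.induct)
  case (Seq P s t s' Q u' s3)
  from Seq.prems obtain t1 s1 u1 where
    "u = t1 + u1" and 1: "exec P s t1 s1" and 2: "exec Q s1 u1 s''"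
    by (rule SeqE)
  moreover from Seq.IH(1)[OF 1] have "t = t1 \<and> s' = s1" .
  moreover with 2 Seq.IH(2)[of u1 s''] have "u' = u1 \<and> s3 = s''" by simp
  ultimately show ?case by simp
next
  case (Cond_true e s P t s' Q)
  from Cond_true.prems Cond_true.hyps(1) obtain t1 where
    "u = 1 + cost e + t1" and 1: "exec P s t1 s''"
    by (auto elim: CondE)
  with Cond_true.IH[OF 1] show ?case by simp
next
  case (Cond_false e s Q t s' P)
  from Cond_false.prems Cond_false.hyps(1) obtain t1 where
    "u = 1 + cost e + t1" and 1: "exec Q s t1 s''"
    by (auto elim: CondE)
  with Cond_false.IH[OF 1] show ?case by simp
next
  case (While_false e s P)
  from While_false.prems While_false.hyps show ?case by (auto elim: WhileE)
next
  case (While_true e s P t s' u' s3)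
  from While_true.prems While_true.hyps(1) obtain t1 s1 u1 where
    "u = 1 + cost e + t1 + u1" and 1: "exec P s t1 s1" and 2: "exec (While e P) s1 u1 s''"
    by (auto elim: WhileE)
  moreover from While_true.IH(1)[OF 1] have "t = t1 \<and> s' = s1" .
  moreover with 2 While_true.IH(2)[of u1 s''] have "u' = u1 \<and> s3 = s''" by simp
  ultimately show ?case by simp
qed (auto elim: SkipE AssignE StoreE)

text \<open>
  A graph with vertex set \<open>{..<n}\<close> is given by \<open>n\<close> in register 0 and its adjacency matrix in row-major
  order in memory, entry \<open>(i, j)\<close> in cell \<open>i * n + j\<close>; everything else is 0. A program returns a set
  of vertices as its characteristic vector in the memory cells \<open>0, \<dots>, n - 1\<close>.
\<close>

definition input_state :: "nat \<Rightarrow> nat pair_pre_digraph \<Rightarrow> state" where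
  "input_state n G =
     ((\<lambda>_. 0)(0 := n),
      (\<lambda>a. if a < n * n \<and> (a div n, a mod n) \<in> parcs G then 1 else 0))"

definition output_set :: "nat \<Rightarrow> state \<Rightarrow> nat set" where
  "output_set n s = {v. v < n \<and> snd s v = 1}"

end

theory Submission
  imports Defs
begin

text \<open>
  For every ordered pair \<open>(u, v)\<close> fix a shortest path. A set \<open>X\<close> is a mutual-visibility set if no triple
  of a pair \<open>(u, v)\<close> and an inner vertex of its path lies in \<open>X\<close>, that is, if \<open>X\<close> is independent in a
  3-uniform hypergraph with at most \<open>n\<^sup>2 D\<close> edges, where \<open>D\<close> is the average distance. Starting with all
  vertices, delete a vertex of maximum degree as long as there are edges. While \<open>x\<close> vertices remain, at
  most a fraction \<open>(x / n)\<^sup>3\<close> of the edges survives; hence when \<open>x\<close> is about \<open>\<surd>(n / D) / 3\<close>, there are at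
  most \<open>x / 2\<close> edges, and at least \<open>x / 2\<close> vertices are never deleted. The paths come from one
  Bellman-Ford computation per target \<open>v\<close>, which records for each vertex its successor towards \<open>v\<close>.
\<close>

section \<open>Distances and shortest paths\<close>

lemma arcs_ends_with_proj: "arcs_ends (with_proj G) = parcs G"
  by (auto simp: arcs_ends_conv)

lemma vwalk_Cons_iff:
  "vwalk (x # p) (with_proj G) \<longleftrightarrow>
     x \<in> pverts G \<and> (p = [] \<or> (x, hd p) \<in> parcs G \<and> vwalk p (with_proj G))"
  by (cases p) (auto simp: vwalk_def arcs_ends_with_proj)

lemma length_vwalk_to_vpath_le: "length (vwalk_to_vpath p) \<le> length p"
proof (induction p rule: vwalk_to_vpath_induct3)
  case (in_set x xs)
  then show ?case
    using length_dropWhile_le[of "\<lambda>y. y \<noteq> x" xs] by simp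
qed auto

lemma vwalk_arcs_map_upt:
  "vwalk_arcs (map f [i..<Suc (i + k)]) = map (\<lambda>j. (f j, f (Suc j))) [i..<i + k]"
proof (induction k arbitrary: i)
  case (Suc k)
  have "map f [i..<Suc (i + Suc k)] = f i # map f [Suc i..<Suc (Suc i + k)]"
    by (simp add: upt_conv_Cons del: upt_Suc)
  moreover have "map f [Suc i..<Suc (Suc i + k)] \<noteq> []" by simp
  moreover have "hd (map f [Suc i..<Suc (Suc i + k)]) = f (Suc i)"
    by (simp add: upt_conv_Cons del: upt_Suc)
  ultimately show ?case
    using Suc[of "Suc i"] by (simp add: upt_conv_Cons del: upt_Suc)
qed simp

locale connected_pair_graph = pair_graph +
  assumes connected: "Digraph_Component.connected (with_proj G)"
begin

lemma path_between_exists: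
  assumes "u \<in> pverts G" "v \<in> pverts G"
  shows "\<exists>p. path_between G u v p"
proof -
  have "strongly_connected (with_proj G)"
    using connected sym_arcs by (intro symmetric_connected_imp_strongly_connected)
  then have "u \<rightarrow>\<^sup>*\<^bsub>with_proj G\<^esub> v"
    using assms by auto
  then obtain p where "vwalk p (with_proj G)" "hd p = u" "last p = v"
    by (auto simp: reachable_vwalk_conv)
  then show ?thesis
    unfolding path_between_def by (rule vwalk_imp_ex_vpath)
qed

lemma gdist_path:
  assumes "u \<in> pverts G" "v \<in> pverts G"
  obtains p where "path_between G u v p" "length p = Suc (gdist G u v)"
proof -
  have "\<exists>k p. path_between G u v p \<and> vwalk_length p = k"
    using path_between_exists[OF assms] by blast
  from LeastI_ex[OF this] obtain p where
    p: "path_between G u v p" "vwalk_length p = gdist G u v"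
    unfolding gdist_def by blast
  then have "p \<noteq> []"
    by (auto simp: path_between_def vpath_def vwalk_def)
  with p(2) have "length p = Suc (gdist G u v)"
    by (cases p) auto
  with p(1) show ?thesis by (rule that)
qed

text \<open>Shortcutting a walk to a path never lengthens it, so distances can be bounded by walks
  without checking distinctness.\<close>

lemma gdist_le_walk:
  assumes "vwalk p (with_proj G)"
  shows "gdist G (hd p) (last p) \<le> length p - 1"
proof -
  have "path_between G (hd p) (last p) (vwalk_to_vpath p)"
    using vwalk_to_vpath_vpath[OF assms]
    by (simp add: path_between_def vwalk_to_vpath_hd vwalk_to_vpath_last)
  then have "gdist G (hd p) (last p) \<le> vwalk_length (vwalk_to_vpath p)"
    unfolding gdist_def by (intro Least_le) blast
  then show ?thesis
    using length_vwalk_to_vpath_le[of p] by simp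
qed

lemma gdist_self: "u \<in> pverts G \<Longrightarrow> gdist G u u = 0"
  using gdist_le_walk[of "[u]"] by (simp add: vwalk_Cons_iff)

lemma gdist_eq_0_iff:
  assumes "u \<in> pverts G" "v \<in> pverts G"
  shows "gdist G u v = 0 \<longleftrightarrow> u = v"
proof
  assume "gdist G u v = 0"
  moreover obtain p where "path_between G u v p" "length p = Suc (gdist G u v)"
    using gdist_path[OF assms] .
  ultimately show "u = v"
    by (cases p) (auto simp: path_between_def)
qed (use gdist_self assms in auto)

lemma gdist_arc_le:
  assumes "(x, y) \<in> parcs G" "v \<in> pverts G"
  shows "gdist G x v \<le> Suc (gdist G y v)"
proof -
  have "x \<in> pverts G" "y \<in> pverts G"
    using assms by (auto dest: wellformed')
  then obtain p where p: "path_between G y v p" "length p = Suc (gdist G y v)"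
    using gdist_path assms by blast
  then have "vwalk (x # p) (with_proj G)" "p \<noteq> []"
    using assms \<open>x \<in> pverts G\<close> by (auto simp: vwalk_Cons_iff path_between_def vpath_def)
  with gdist_le_walk[of "x # p"] p show ?thesis
    by (simp add: path_between_def)
qed

text \<open>The tail of a shortest path is a walk to \<open>v\<close> with one arc less;
  \<open>gdist_arc_le\<close> excludes a larger drop.\<close>

lemma gdist_next:
  assumes "u \<in> pverts G" "v \<in> pverts G" "u \<noteq> v"
  obtains y where "(u, y) \<in> parcs G" "Suc (gdist G y v) = gdist G u v"
proof -
  obtain p where p: "path_between G u v p" "length p = Suc (gdist G u v)"
    using gdist_path[OF assms(1,2)] .
  from p(1) have "p \<noteq> []" by (auto simp: path_between_def vpath_def vwalk_def)
  with p(1) obtain q where q: "p = u # q" by (cases p) (auto simp: path_between_def)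
  with p assms(3) have "q \<noteq> []" by (auto simp: path_between_def)
  with p q have a: "(u, hd q) \<in> parcs G" and w: "vwalk q (with_proj G)" and l: "last q = v"
    by (auto simp: path_between_def vpath_def vwalk_Cons_iff)
  have "Suc (gdist G (hd q) v) \<le> gdist G u v"
    using gdist_le_walk[OF w] l p(2) q \<open>q \<noteq> []\<close> by (cases q) auto
  with gdist_arc_le[OF a assms(2)] a show ?thesis
    by (intro that[of "hd q"]) auto
qed

lemma gdist_less_card:
  assumes "u \<in> pverts G" "v \<in> pverts G"
  shows "gdist G u v < card (pverts G)"
proof -
  obtain p where p: "path_between G u v p" "length p = Suc (gdist G u v)"
    using gdist_path[OF assms] .
  then have "distinct p" "set p \<subseteq> pverts G"
    by (auto simp: path_between_def vpath_def vwalk_def)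
  then have "length p \<le> card (pverts G)"
    by (metis card_mono distinct_card pair_finite_verts)
  with p show ?thesis by simp
qed

lemma gdist_le_commute:
  assumes "u \<in> pverts G" "v \<in> pverts G"
  shows "gdist G v u \<le> gdist G u v"
proof -
  obtain p where p: "path_between G u v p" "length p = Suc (gdist G u v)"
    using gdist_path[OF assms] .
  then have w: "vwalk p (with_proj G)" "hd p = u" "last p = v"
    by (auto simp: path_between_def vpath_def)
  then have "vwalk (rev p) (with_proj G)"
    by (auto simp: vwalk_def set_vwalk_arcs_rev arcs_ends_with_proj intro: arcs_symmetric)
  from gdist_le_walk[OF this] w p show ?thesis
    by (simp add: hd_rev last_rev)
qed

lemma gdist_commute:
  assumes "u \<in> pverts G" "v \<in> pverts G"
  shows "gdist G u v = gdist G v u"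
  using gdist_le_commute assms by (simp add: order_antisym)

end

text \<open>
  \<open>nx v u\<close> is the vertex after \<open>u\<close> on a shortest path to \<open>v\<close>; it is \<open>v\<close> for \<open>u = v\<close>, so that iterating
  \<open>nx v\<close> traces a path that stops at \<open>v\<close>.
\<close>

locale next_hop = connected_pair_graph +
  fixes nx :: "'a \<Rightarrow> 'a \<Rightarrow> 'a"
  assumes nx_self: "v \<in> pverts G \<Longrightarrow> nx v v = v"
    and nx_arc: "u \<in> pverts G \<Longrightarrow> v \<in> pverts G \<Longrightarrow> u \<noteq> v \<Longrightarrow> (u, nx v u) \<in> parcs G"
    and nx_dist: "u \<in> pverts G \<Longrightarrow> v \<in> pverts G \<Longrightarrow> u \<noteq> v \<Longrightarrow>
      Suc (gdist G (nx v u) v) = gdist G u v"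
begin

definition hop :: "'a \<Rightarrow> 'a \<Rightarrow> nat \<Rightarrow> 'a" where
  "hop v u i = (nx v ^^ i) u"

lemma hop_0 [simp]: "hop v u 0 = u"
  and hop_Suc: "hop v u (Suc i) = nx v (hop v u i)"
  by (simp_all add: hop_def)

lemma hop_in_verts: "u \<in> pverts G \<Longrightarrow> v \<in> pverts G \<Longrightarrow> hop v u i \<in> pverts G"
proof (induction i)
  case (Suc i)
  then show ?case
    by (cases "hop v u i = v") (auto simp: hop_Suc nx_self dest: nx_arc wellformed')
qed simp

text \<open>Truncated subtraction also covers hops after arrival: the walk then stays at
  \<open>v\<close>, at distance 0.\<close>

lemma gdist_hop:
  assumes "u \<in> pverts G" "v \<in> pverts G"
  shows "gdist G (hop v u i) v = gdist G u v - i"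
proof (induction i)
  case (Suc i)
  have h: "hop v u i \<in> pverts G" using hop_in_verts assms .
  show ?case
  proof (cases "hop v u i = v")
    case True
    then have "gdist G u v - i = 0"
      using Suc gdist_self assms by simp
    with True show ?thesis
      using assms by (simp add: hop_Suc nx_self gdist_self)
  next
    case False
    from nx_dist[OF h assms(2) this] Suc show ?thesis
      by (simp add: hop_Suc)
  qed
qed simp

lemma hop_eq_target_iff:
  assumes "u \<in> pverts G" "v \<in> pverts G"
  shows "hop v u i = v \<longleftrightarrow> gdist G u v \<le> i"
  using gdist_hop[OF assms, of i] gdist_eq_0_iff[OF hop_in_verts[OF assms] assms(2), of i]
  by auto

lemma hop_arc:
  assumes "u \<in> pverts G" "v \<in> pverts G" "i < gdist G u v"
  shows "(hop v u i, hop v u (Suc i)) \<in> parcs G"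
  using nx_arc[OF hop_in_verts[OF assms(1,2)] assms(2), of i] hop_eq_target_iff[OF assms(1,2), of i]
    assms(3) by (simp add: hop_Suc)

lemma shortest_path_hop:
  assumes "u \<in> pverts G" "v \<in> pverts G"
  shows "shortest_path_between G u v (map (hop v u) [0..<Suc (gdist G u v)])"
    (is "shortest_path_between G u v ?p")
proof -
  let ?d = "gdist G u v"
  \<comment> \<open>Up to index \<open>?d\<close> the distance to \<open>v\<close> drops with every
    hop, so no vertex repeats.\<close>
  have "inj_on (hop v u) {0..<Suc ?d}"
  proof (rule inj_onI)
    fix i j assume "i \<in> {0..<Suc ?d}" "j \<in> {0..<Suc ?d}" "hop v u i = hop v u j"
    then show "i = j"
      using gdist_hop[OF assms, of i] gdist_hop[OF assms, of j] by simp
  qed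
  then have "distinct ?p"
    by (simp add: distinct_map del: upt_Suc)
  moreover have "vwalk ?p (with_proj G)"
    using vwalk_arcs_map_upt[of "hop v u" 0 ?d] hop_in_verts[OF assms] hop_arc[OF assms]
    by (auto simp: vwalk_def arcs_ends_with_proj simp del: upt_Suc)
  moreover have "hd ?p = u" by (simp add: upt_conv_Cons del: upt_Suc)
  moreover have "last ?p = v"
    using hop_eq_target_iff[OF assms, of ?d] by simp
  ultimately show ?thesis
    by (auto simp: shortest_path_between_def path_between_def)
qed

lemma visible_hop:
  assumes "u \<in> pverts G" "v \<in> pverts G"
    and "\<And>i. hop v u (Suc i) \<noteq> v \<Longrightarrow> hop v u (Suc i) \<notin> X"
  shows "visible G X u v"
proof -
  let ?d = "gdist G u v"
  have "butlast [Suc 0..<Suc ?d] = [Suc 0..<?d]"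
    by (cases ?d) simp_all
  then have "butlast (tl (map (hop v u) [0..<Suc ?d])) = map (hop v u) [Suc 0..<?d]"
    by (simp flip: map_tl map_butlast del: upt_Suc)
  then have "internal_verts (map (hop v u) [0..<Suc ?d]) = hop v u ` {Suc 0..<?d}"
    by (simp add: internal_verts_def)
  moreover have "hop v u i \<notin> X" if "i \<in> {Suc 0..<?d}" for i
    using assms(3)[of "i - 1"] hop_eq_target_iff[OF assms(1,2), of i] that by auto
  ultimately have "internal_verts (map (hop v u) [0..<Suc ?d]) \<inter> X = {}" by auto
  with shortest_path_hop[OF assms(1,2)] show ?thesis
    unfolding visible_def by blast
qed

end

section \<open>Greedy independent sets in 3-uniform hypergraphs\<close>

text \<open>Edges are indices with vertex sets attached by \<open>h\<close>, so one vertex set may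
  carry several edges, such as edges arising from the pairs \<open>(u, v)\<close> and
  \<open>(v, u)\<close>.\<close>

definition induced :: "'e set \<Rightarrow> ('e \<Rightarrow> 'a set) \<Rightarrow> 'a set \<Rightarrow> 'e set" where
  "induced E h X = {e \<in> E. h e \<subseteq> X}"

definition hdeg :: "'e set \<Rightarrow> ('e \<Rightarrow> 'a set) \<Rightarrow> 'a set \<Rightarrow> 'a \<Rightarrow> nat" where
  "hdeg E h X w = card {e \<in> induced E h X. w \<in> h e}"

text \<open>A relation leaves ties between vertices of maximum degree open, so any choice made by
  the program is covered. Idling on edge-free sets allows a fixed number of rounds.\<close>

definition greedy_step :: "'e set \<Rightarrow> ('e \<Rightarrow> 'a set) \<Rightarrow> 'a set \<Rightarrow> 'a set \<Rightarrow> bool" where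
  "greedy_step E h X Y \<longleftrightarrow>
     (if induced E h X = {} then Y = X
      else \<exists>w\<in>X. (\<forall>w'\<in>X. hdeg E h X w' \<le> hdeg E h X w) \<and> Y = X - {w})"

locale three_uniform =
  fixes E :: "'e set" and h :: "'e \<Rightarrow> 'a set" and V :: "'a set"
  assumes finite_edges: "finite E"
    and card_edge: "e \<in> E \<Longrightarrow> card (h e) = 3"
    and finite_verts: "finite V"
begin

abbreviation "ind \<equiv> induced E h"
abbreviation "deg \<equiv> hdeg E h"
abbreviation "step \<equiv> greedy_step E h"

lemma finite_ind [simp]: "finite (ind X)"
  using finite_edges by (simp add: induced_def)

text \<open>Double counting of incidences: every edge has three vertices.\<close>

lemma sum_hdeg:
  assumes "finite X"
  shows "(\<Sum>w\<in>X. deg X w) = 3 * card (ind X)"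
proof -
  have "(\<Sum>w\<in>X. deg X w) = (\<Sum>w\<in>X. \<Sum>e\<in>ind X. if w \<in> h e then 1 else 0)"
    by (simp add: hdeg_def flip: sum.inter_filter)
  also have "\<dots> = (\<Sum>e\<in>ind X. \<Sum>w\<in>X. if w \<in> h e then 1 else 0)"
    by (rule sum.swap)
  also have "\<dots> = (\<Sum>e\<in>ind X. 3)"
  proof (rule sum.cong)
    fix e assume e: "e \<in> ind X"
    then have "{w \<in> X. w \<in> h e} = h e" by (auto simp: induced_def)
    then show "(\<Sum>w\<in>X. if w \<in> h e then 1 else 0) = (3::nat)"
      using e card_edge assms by (simp add: induced_def flip: sum.inter_filter)
  qed simp
  finally show ?thesis by simp
qed

lemma card_ge_3: "finite X \<Longrightarrow> ind X \<noteq> {} \<Longrightarrow> 3 \<le> card X"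
  by (auto simp: induced_def) (metis card_edge card_mono)

text \<open>The maximum degree is at least the average degree, known from \<open>sum_hdeg\<close>.
  Deleting \<open>w\<close> destroys exactly the edges through \<open>w\<close>.\<close>

lemma greedy_remove:
  assumes "finite X" "ind X \<noteq> {}" "w \<in> X" "\<And>w'. w' \<in> X \<Longrightarrow> deg X w' \<le> deg X w"
  shows "3 * card (ind X) \<le> card X * deg X w"
    and "card (ind (X - {w})) + deg X w = card (ind X)"
    and "1 \<le> deg X w"
proof -
  show *: "3 * card (ind X) \<le> card X * deg X w"
    using sum_bounded_above[of X "deg X" "deg X w"] assms(4) sum_hdeg[OF assms(1)] by simp
  have "ind X = ind (X - {w}) \<union> {e \<in> ind X. w \<in> h e}"
    and "ind (X - {w}) \<inter> {e \<in> ind X. w \<in> h e} = {}"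
    by (auto simp: induced_def)
  then show "card (ind (X - {w})) + deg X w = card (ind X)"
    unfolding hdeg_def by (metis (no_types, lifting) card_Un_disjoint finite_Un finite_ind)
  show "1 \<le> deg X w"
    using * assms(2) by (cases "deg X w") (auto simp: card_eq_0_iff)
qed

lemma greedy_step_subset: "step Y X \<Longrightarrow> X \<subseteq> Y"
  by (auto simp: greedy_step_def split: if_splits)

lemma greedy_subset: "(step ^^ k) V X \<Longrightarrow> X \<subseteq> V"
  by (induction k arbitrary: X) (auto dest!: greedy_step_subset)

lemma greedy_progress: "(step ^^ k) V X \<Longrightarrow> ind X = {} \<or> card X + k \<le> card V"
proof (induction k arbitrary: X)
  case (Suc k)
  then obtain Y where Y: "(step ^^ k) V Y" "step Y X" by auto
  have "finite Y" using greedy_subset[OF Y(1)] finite_verts finite_subset by blast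
  with Suc.IH[OF Y(1)] Y(2) show ?case
    by (auto simp: greedy_step_def card_Diff_singleton_if split: if_splits)
      (metis One_nat_def Suc_pred add_Suc_right add_Suc card_gt_0_iff empty_iff)
qed simp

text \<open>If edges survived \<open>card V\<close> rounds, every round would have deleted a vertex
  and none would be left, yet an edge needs three.\<close>

lemma greedy_terminates: "(step ^^ card V) V X \<Longrightarrow> ind X = {}"
  using greedy_progress[of "card V" X] greedy_subset[of "card V" X] finite_verts card_ge_3[of X]
  by (cases "ind X = {}") (auto dest: finite_subset)

text \<open>A deletion takes place only if an edge, hence at least three vertices, is
  present.\<close>

lemma greedy_nonempty:
  assumes "V \<noteq> {}"
  shows "(step ^^ k) V X \<Longrightarrow> X \<noteq> {}"
proof (induction k arbitrary: X)
  case (Suc k)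
  then obtain Y where Y: "(step ^^ k) V Y" "step Y X" by auto
  have "finite Y" using greedy_subset[OF Y(1)] finite_verts finite_subset by blast
  show ?case
  proof (cases "ind Y = {}")
    case True
    with Y Suc.IH[OF Y(1)] show ?thesis by (simp add: greedy_step_def)
  next
    case False
    with Y obtain w where "w \<in> Y" "X = Y - {w}" by (auto simp: greedy_step_def)
    then have "card X = card Y - 1" by simp
    with card_ge_3[OF \<open>finite Y\<close> False] show ?thesis by auto
  qed
qed (use assms in simp)

text \<open>
  Deleting a vertex of maximum degree thins out the edges at least as well as passing to a random
  subset does, since \<open>1 - 3 / x \<le> (1 - 1 / x)\<^sup>3\<close>. This is used as long as the set has at least \<open>J\<close>
  elements; from then on there are at most half as many edges as vertices, and every further deletion
  of a vertex destroys an edge.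
\<close>

lemma greedy_size:
  fixes J :: real
  assumes J: "1 \<le> J" "J \<le> card V" "8 * card E * J\<^sup>2 \<le> real (card V) ^ 3"
  shows "(step ^^ k) V X \<Longrightarrow>
    J \<le> card X \<and> card (ind X) * real (card V) ^ 3 \<le> card E * real (card X) ^ 3 \<or>
    J / 2 \<le> real (card X) - card (ind X)"
proof (induction k arbitrary: X)
  case 0
  have "card (ind V) \<le> card E"
    using finite_edges by (intro card_mono) (auto simp: induced_def)
  with 0 J show ?case by (auto intro: mult_right_mono)
next
  case (Suc k)
  then obtain Y where Y: "(step ^^ k) V Y" "step Y X" by auto
  have fin: "finite Y" using greedy_subset[OF Y(1)] finite_verts finite_subset by blast
  show ?case
  proof (cases "ind Y = {}")
    case True
    with Y Suc.IH[OF Y(1)] show ?thesis by (auto simp: greedy_step_def)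
  next
    case False
    with Y obtain w where w: "w \<in> Y" "\<And>w'. w' \<in> Y \<Longrightarrow> deg Y w' \<le> deg Y w" "X = Y - {w}"
      by (auto simp: greedy_step_def)
    note r = greedy_remove[OF fin False w(1,2), folded w(3)]
    define y e d n m where "y = real (card Y)" and "e = real (card (ind Y))"
      and "d = real (deg Y w)" and "n = real (card V)" and "m = real (card E)"
    have cX: "real (card X) = y - 1"
      using fin w card_ge_3[OF fin False] by (simp add: y_def of_nat_diff)
    have cE: "real (card (ind X)) = e - d"
      using r(2) by (simp add: e_def d_def flip: of_nat_add)
    have y: "3 \<le> y" using card_ge_3[OF fin False] by (simp add: y_def)
    have d: "3 * e \<le> y * d" using r(1) unfolding e_def d_def y_def
      by (metis of_nat_le_iff of_nat_mult of_nat_numeral)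
    have d1: "1 \<le> d" using r(3) by (simp add: d_def)
    have n: "0 < n" using J by (simp add: n_def)
    have m: "0 \<le> m" and e0: "0 \<le> e" by (simp_all add: m_def e_def)
    \<comment> \<open>In case 1 the size is still at least \<open>J\<close> after the deletion; case
      2 is the deletion that falls below \<open>J\<close> and passes to the second disjunct; case 3
      stays there.\<close>
    from Suc.IH[OF Y(1)] consider
      "J + 1 \<le> y" "e * n ^ 3 \<le> m * y ^ 3"
      | "J \<le> y" "y < J + 1" "e * n ^ 3 \<le> m * y ^ 3"
      | "J / 2 \<le> y - e"
      unfolding y_def e_def n_def m_def by fastforce
    then show ?thesis
    proof cases
      case 1
      have "y * (e - d) \<le> (y - 3) * e" using d by (simp add: algebra_simps)
      then have "y * (e - d) * n ^ 3 \<le> (y - 3) * (e * n ^ 3)"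
        using n by (simp add: mult_right_mono flip: mult.assoc)
      also have "\<dots> \<le> (y - 3) * (m * y ^ 3)"
        using 1 y by (intro mult_left_mono) auto
      also have "\<dots> = y * (m * ((y - 3) * y\<^sup>2))"
        by (simp add: power2_eq_square power3_eq_cube)
      also have "\<dots> \<le> y * (m * (y - 1) ^ 3)"
      proof (intro mult_left_mono)
        have "(y - 1) ^ 3 - (y - 3) * y\<^sup>2 = 3 * y - 1"
          by (simp add: power2_eq_square power3_eq_cube algebra_simps)
        with y show "(y - 3) * y\<^sup>2 \<le> (y - 1) ^ 3" by linarith
      qed (use y m in auto)
      finally have "y * ((e - d) * n ^ 3) \<le> y * (m * (y - 1) ^ 3)" by (simp add: mult.assoc)
      then have "(e - d) * n ^ 3 \<le> m * (y - 1) ^ 3" using y by simp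
      with 1 show ?thesis unfolding cX cE n_def m_def by simp
    next
      case 2
      \<comment> \<open>Here \<open>y < J + 1 \<le> 2 * J\<close>. The constant 8 in the hypothesis
        pays for the resulting factor 4 and leaves \<open>e \<le> y / 2\<close>.\<close>
      have "y\<^sup>2 \<le> (2 * J)\<^sup>2" using 2 J y by (intro power_mono) auto
      then have "m * y\<^sup>2 \<le> m * (4 * J\<^sup>2)" using m by (intro mult_left_mono) (auto simp: power2_eq_square)
      moreover have "m * (4 * J\<^sup>2) \<le> n ^ 3 / 2" using J(3) by (simp add: m_def n_def)
      ultimately have "y * (m * y\<^sup>2) \<le> y * (n ^ 3 / 2)" using y by (intro mult_left_mono) auto
      with 2(3) have "e * n ^ 3 \<le> (y / 2) * n ^ 3" by (simp add: power2_eq_square power3_eq_cube mult_ac)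
      then have "e \<le> y / 2" using n by simp
      \<comment> \<open>Before the deletion \<open>y - e\<close> is at least \<open>y / 2\<close>,
        hence at least \<open>J / 2\<close>; the lost vertex is made up for by at least one lost
        edge.\<close>
      with 2 d1 have "J / 2 \<le> (y - 1) - (e - d)" by argo
      then show ?thesis unfolding cX cE by simp
    next
      case 3
      with d1 show ?thesis unfolding cX cE by simp
    qed
  qed
qed

end

section \<open>For-loop programs\<close>

text \<open>
  Programs whose only loops are \<open>for i = 0, \<dots>, R - 1\<close>, where \<open>R\<close> is register 0 and holds the number
  of vertices throughout. They terminate in polynomial time, so that only their state transformers
  \<open>den P\<close> need to be studied.
\<close>

datatype lprog =
    LSkip
  | LAssign nat expr
  | LStore expr expr
  | LSeq lprog lprog (infixr ";;" 60)
  | LCond expr lprog lprog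
  | LFor nat lprog

primrec assigned :: "lprog \<Rightarrow> nat set" where
  "assigned LSkip = {}"
| "assigned (LAssign i e) = {i}"
| "assigned (LStore a e) = {}"
| "assigned (LSeq P Q) = assigned P \<union> assigned Q"
| "assigned (LCond e P Q) = assigned P \<union> assigned Q"
| "assigned (LFor i P) = insert i (assigned P)"

text \<open>Register 0 and the counter of a running loop are protected, so a loop makes exactly as
  many rounds as register 0 says.\<close>

primrec wf_lprog :: "lprog \<Rightarrow> bool" where
  "wf_lprog LSkip = True"
| "wf_lprog (LAssign i e) = (i \<noteq> 0)"
| "wf_lprog (LStore a e) = True"
| "wf_lprog (LSeq P Q) = (wf_lprog P \<and> wf_lprog Q)"
| "wf_lprog (LCond e P Q) = (wf_lprog P \<and> wf_lprog Q)"
| "wf_lprog (LFor i P) = (i \<noteq> 0 \<and> i \<notin> assigned P \<and> wf_lprog P)"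

abbreviation set_reg :: "nat \<Rightarrow> nat \<Rightarrow> state \<Rightarrow> state" where
  "set_reg i k s \<equiv> ((fst s)(i := k), snd s)"

primrec den :: "lprog \<Rightarrow> state \<Rightarrow> state" where
  "den LSkip s = s"
| "den (LAssign i e) s = set_reg i (val e s) s"
| "den (LStore a e) s = (fst s, (snd s)(val a s := val e s))"
| "den (LSeq P Q) s = den Q (den P s)"
| "den (LCond e P Q) s = (if val e s \<noteq> 0 then den P s else den Q s)"
| "den (LFor i P) s =
     ((\<lambda>s. set_reg i (Suc (fst s i)) (den P s)) ^^ fst s 0) (set_reg i 0 s)"

primrec compile :: "lprog \<Rightarrow> prog" where
  "compile LSkip = Skip"
| "compile (LAssign i e) = Assign i e"
| "compile (LStore a e) = Store a e"
| "compile (LSeq P Q) = Seq (compile P) (compile Q)"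
| "compile (LCond e P Q) = Cond e (compile P) (compile Q)"
| "compile (LFor i P) = Seq (Assign i (Const 0))
     (While (Sub (Reg 0) (Reg i)) (Seq (compile P) (Assign i (Add (Reg i) (Const 1)))))"

text \<open>The monomial \<open>[:0, 1:]\<close> stands for the content of register 0. In a loop, 6
  pays for initialising the counter (2) and the failing test (4), and 8 for the successful test (4)
  and the increment (4) of each round.\<close>

primrec time :: "lprog \<Rightarrow> nat poly" where
  "time LSkip = 1"
| "time (LAssign i e) = [:1 + cost e:]"
| "time (LStore a e) = [:1 + cost a + cost e:]"
| "time (LSeq P Q) = time P + time Q"
| "time (LCond e P Q) = [:1 + cost e:] + time P + time Q"
| "time (LFor i P) = [:6:] + [:0, 1:] * (time P + [:8:])"

lemma den_frame: "r \<notin> assigned P \<Longrightarrow> fst (den P s) r = fst s r"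
proof (induction P arbitrary: s)
  case (LFor i P)
  have "fst (((\<lambda>s. set_reg i (Suc (fst s i)) (den P s)) ^^ k) s) r = fst s r" for k s
    by (induction k) (use LFor in auto)
  with LFor show ?case by simp
qed auto

primrec no_store :: "lprog \<Rightarrow> bool" where
  "no_store LSkip = True"
| "no_store (LAssign i e) = True"
| "no_store (LStore a e) = False"
| "no_store (LSeq P Q) = (no_store P \<and> no_store Q)"
| "no_store (LCond e P Q) = (no_store P \<and> no_store Q)"
| "no_store (LFor i P) = no_store P"

lemma den_no_store: "no_store P \<Longrightarrow> snd (den P s) = snd s"
proof (induction P arbitrary: s)
  case (LFor i P)
  have "snd (((\<lambda>s. set_reg i (Suc (fst s i)) (den P s)) ^^ k) s) = snd s" for k s
    by (induction k) (use LFor in auto)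
  with LFor show ?case by simp
qed auto

lemma zero_not_assigned: "wf_lprog P \<Longrightarrow> 0 \<notin> assigned P"
  by (induction P) auto

lemma exec_compile:
  "wf_lprog P \<Longrightarrow> \<exists>t. exec (compile P) s t (den P s) \<and> t \<le> poly (time P) (fst s 0)"
proof (induction P arbitrary: s)
  case LSkip
  then show ?case using exec.Skip by fastforce
next
  case (LAssign i e)
  then show ?case using exec.Assign by fastforce
next
  case (LStore a e)
  then show ?case using exec.Store by fastforce
next
  case (LSeq P Q)
  from LSeq.IH(1)[of s] LSeq.prems obtain t where
    t: "exec (compile P) s t (den P s)" "t \<le> poly (time P) (fst s 0)" by auto
  from LSeq.IH(2)[of "den P s"] LSeq.prems obtain u where
    u: "exec (compile Q) (den P s) u (den Q (den P s))" "u \<le> poly (time Q) (fst (den P s) 0)" by auto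
  have "fst (den P s) 0 = fst s 0"
    using LSeq.prems by (simp add: den_frame zero_not_assigned)
  with t u exec.Seq[OF t(1) u(1)] show ?case by fastforce
next
  case (LCond e P Q)
  show ?case
  proof (cases "val e s = 0")
    case True
    from LCond.IH(2)[of s] LCond.prems obtain t where
      t: "exec (compile Q) s t (den Q s)" "t \<le> poly (time Q) (fst s 0)" by auto
    from exec.Cond_false[OF True t(1), of "compile P"] True t(2) show ?thesis by fastforce
  next
    case False
    from LCond.IH(1)[of s] LCond.prems obtain t where
      t: "exec (compile P) s t (den P s)" "t \<le> poly (time P) (fst s 0)" by auto
    from exec.Cond_true[OF False t(1), of "compile Q"] False t(2) show ?thesis by fastforce
  qed
next
  case (LFor i P)
  then have i: "i \<noteq> 0" "i \<notin> assigned P" "0 \<notin> assigned P" "wf_lprog P"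
    by (auto simp: zero_not_assigned)
  define n where "n = fst s 0"
  let ?body = "\<lambda>s. set_reg i (Suc (fst s i)) (den P s)"
  let ?W = "While (Sub (Reg 0) (Reg i)) (Seq (compile P) (Assign i (Add (Reg i) (Const 1))))"
  \<comment> \<open>Here \<open>k\<close> counts the remaining rounds, so that the induction peels
    off the first one, as \<open>While_true\<close> does.\<close>
  have loop: "\<exists>t. exec ?W s t ((?body ^^ k) s) \<and> t \<le> 4 + k * (poly (time P) n + 8)"
    if "fst s 0 = n" "fst s i + k = n" for k s
    using that
  proof (induction k arbitrary: s)
    case 0
    then have "val (Sub (Reg 0) (Reg i)) s = 0" by simp
    from exec.While_false[OF this] show ?case by fastforce
  next
    case (Suc k)
    then have c: "val (Sub (Reg 0) (Reg i)) s \<noteq> 0" by simp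
    from LFor.IH[OF i(4), of s] Suc.prems obtain t where
      t: "exec (compile P) s t (den P s)" "t \<le> poly (time P) n" by auto
    have f: "fst (den P s) i = fst s i" "fst (den P s) 0 = fst s 0"
      using i by (simp_all add: den_frame)
    have "exec (Assign i (Add (Reg i) (Const 1))) (den P s) 4 (?body s)"
      using exec.Assign[of i "Add (Reg i) (Const 1)" "den P s"] f by (simp add: numeral_eq_Suc)
    from exec.Seq[OF t(1) this]
    have b: "exec (Seq (compile P) (Assign i (Add (Reg i) (Const 1)))) s (t + 4) (?body s)" .
    have "fst (?body s) 0 = n" "fst (?body s) i + k = n"
      using Suc.prems f i by auto
    from Suc.IH[OF this] obtain u where
      u: "exec ?W (?body s) u ((?body ^^ k) (?body s))" "u \<le> 4 + k * (poly (time P) n + 8)"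
      by blast
    from exec.While_true[OF c b u(1)] have
      "exec ?W s (8 + t + u) ((?body ^^ Suc k) s)"
      unfolding funpow_Suc_right by (simp add: add_ac)
    moreover have "8 + t + u \<le> 4 + Suc k * (poly (time P) n + 8)" using t(2) u(2) by simp
    ultimately show ?case by blast
  qed
  have "fst (set_reg i 0 s) 0 = n" "fst (set_reg i 0 s) i + n = n" using i by (simp_all add: n_def)
  from loop[OF this] obtain t where
    t: "exec ?W (set_reg i 0 s) t ((?body ^^ n) (set_reg i 0 s))"
      "t \<le> 4 + n * (poly (time P) n + 8)" by blast
  have a: "exec (Assign i (Const 0)) s 2 (set_reg i 0 s)"
    using exec.Assign[of i "Const 0" s] by (simp add: numeral_eq_Suc)
  from exec.Seq[OF a t(1)] t(2) show ?case
    by (intro exI[of _ "2 + t"]) (simp add: n_def)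
qed

text \<open>Each round may assume the values of register 0 and of the counter, so \<open>I\<close>
  need not track the counter.\<close>

lemma den_LFor_invariant:
  assumes "wf_lprog (LFor i P)" "fst s 0 = n" "I 0 (set_reg i 0 s)"
    and step: "\<And>k s. k < n \<Longrightarrow> fst s 0 = n \<Longrightarrow> fst s i = k \<Longrightarrow> I k s \<Longrightarrow>
      I (Suc k) (set_reg i (Suc k) (den P s))"
  shows "I n (den (LFor i P) s)"
proof -
  let ?body = "\<lambda>s. set_reg i (Suc (fst s i)) (den P s)"
  have "I k ((?body ^^ k) (set_reg i 0 s)) \<and> fst ((?body ^^ k) (set_reg i 0 s)) 0 = n
      \<and> fst ((?body ^^ k) (set_reg i 0 s)) i = k" if "k \<le> n" for k
    using that
  proof (induction k)
    case (Suc k)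
    then show ?case
      using step[of k "(?body ^^ k) (set_reg i 0 s)"] assms(1)
      by (simp add: den_frame zero_not_assigned fun_upd_same fun_upd_other del: fun_upd_apply)
  qed (use assms in auto)
  with assms(2) show ?thesis by simp
qed

declare den.simps(6) [simp del]

text \<open>Logic from truncated subtraction: \<open>Sub (Const 1) e\<close> is negation, and a sum
  is zero iff both summands are. In the same way \<open>Neq\<close> computes |e - f|.\<close>

definition And :: "expr \<Rightarrow> expr \<Rightarrow> expr" where
  "And e f = Sub (Const 1) (Add (Sub (Const 1) e) (Sub (Const 1) f))"

definition Neq :: "expr \<Rightarrow> expr \<Rightarrow> expr" where
  "Neq e f = Add (Sub e f) (Sub f e)"

definition Eq :: "expr \<Rightarrow> expr \<Rightarrow> expr" where
  "Eq e f = Sub (Const 1) (Neq e f)"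

lemma val_And [simp]: "val (And e f) s = (if val e s \<noteq> 0 \<and> val f s \<noteq> 0 then 1 else 0)"
  by (simp add: And_def)

lemma val_Neq_eq_0 [simp]: "val (Neq e f) s = 0 \<longleftrightarrow> val e s = val f s"
  by (auto simp: Neq_def)

lemma val_Eq [simp]: "val (Eq e f) s = (if val e s = val f s then 1 else 0)"
  by (auto simp: Eq_def Neq_def)

section \<open>The algorithm and its correctness\<close>

text \<open>Entries of an earlier row precede the start of any later row; this separates cells being
  written from cells to be preserved.\<close>

lemma row_less: "v' < v \<Longrightarrow> x < n \<Longrightarrow> v' * n + x < v * (n::nat)"
proof -
  assume "v' < v" "x < n"
  then have "v' * n + x < Suc v' * n" by simp
  also have "\<dots> \<le> v * n" using \<open>v' < v\<close> by (intro mult_right_mono) auto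
  finally show ?thesis .
qed

text \<open>
  Memory: cells below \<open>n\<^sup>2\<close> hold the adjacency matrix, later the characteristic vector of the current
  set; cell \<open>n\<^sup>2 + x\<close> holds the distance estimate of \<open>x\<close> to the current target \<open>v\<close>, and cell
  \<open>n\<^sup>2 + n + v n + x\<close> the vertex after \<open>x\<close> on the path to \<open>v\<close>.

  Registers: 1 is \<open>n\<^sup>2\<close>; 2 is \<open>v\<close>; 3 is \<open>n\<^sup>2 + n + v n\<close>; 4 counts rounds or steps of a walk; 5 is \<open>x\<close>;
  6 is \<open>x n\<close>; 7 is a neighbour of \<open>x\<close> or the source of a walk; 8 counts deletions; 9 and 10 are the
  maximum degree and a vertex attaining it; 11 is the vertex whose degree is accumulated in 12.
\<close>

definition square_prog :: lprog where
  "square_prog = LFor 2 (LAssign 1 (Add (Reg 1) (Reg 0)))"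

text \<open>The \<open>Sub\<close> is nonzero iff the route through the neighbour is strictly
  shorter than the estimate. Register 6 carries the row offset, since the machine cannot
  multiply.\<close>

definition relax_prog :: lprog where
  "relax_prog = LFor 7
     (LCond (And (Mem (Add (Reg 6) (Reg 7)))
        (Sub (Mem (Add (Reg 1) (Reg 5))) (Add (Mem (Add (Reg 1) (Reg 7))) (Const 1))))
       (LStore (Add (Reg 1) (Reg 5)) (Add (Mem (Add (Reg 1) (Reg 7))) (Const 1)) ;;
        LStore (Add (Reg 3) (Reg 5)) (Reg 7))
       LSkip)"

definition round_prog :: lprog where
  "round_prog = LAssign 6 (Const 0) ;; LFor 5 (relax_prog ;; LAssign 6 (Add (Reg 6) (Reg 0)))"

text \<open>The value \<open>n\<close> plays the role of infinity, as all distances are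
  smaller.\<close>

definition init_prog :: lprog where
  "init_prog = LFor 5 (LStore (Add (Reg 1) (Reg 5)) (Reg 0)) ;;
     LStore (Add (Reg 1) (Reg 2)) (Const 0) ;; LStore (Add (Reg 3) (Reg 2)) (Reg 2)"

definition next_prog :: lprog where
  "next_prog = square_prog ;; LAssign 3 (Add (Reg 1) (Reg 0)) ;;
     LFor 2 (init_prog ;; LFor 4 round_prog ;; LAssign 3 (Add (Reg 3) (Reg 0)))"

text \<open>Cells below \<open>n\<close> serve as membership tests, and the sum of equalities acts
  as a disjunction. The \<open>Neq\<close> discards positions after the walk has arrived at its
  target.\<close>

definition hit_expr :: expr where
  "hit_expr = And (And (Mem (Reg 7)) (And (Mem (Reg 2)) (Mem (Reg 5))))
     (And (Neq (Reg 5) (Reg 2))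
       (Add (Eq (Reg 11) (Reg 7)) (Add (Eq (Reg 11) (Reg 2)) (Eq (Reg 11) (Reg 5)))))"

definition walk_prog :: lprog where
  "walk_prog = LAssign 5 (Reg 7) ;; LFor 4
     (LAssign 5 (Mem (Add (Reg 3) (Reg 5))) ;;
      LAssign 12 (Add (Reg 12) hit_expr))"

definition degree_prog :: lprog where
  "degree_prog = LAssign 12 (Const 0) ;; LAssign 3 (Add (Reg 1) (Reg 0)) ;;
     LFor 2 (LFor 7 walk_prog ;; LAssign 3 (Add (Reg 3) (Reg 0)))"

text \<open>Starting from 0 with a strict comparison, register 9 stays 0 iff all degrees are 0; only
  then is nothing deleted.\<close>

definition step_prog :: lprog where
  "step_prog = LAssign 9 (Const 0) ;; LAssign 10 (Const 0) ;;
     LFor 11 (degree_prog ;;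
       LCond (Sub (Reg 12) (Reg 9)) (LAssign 9 (Reg 12) ;; LAssign 10 (Reg 11)) LSkip) ;;
     LCond (Reg 9) (LStore (Reg 10) (Const 0)) LSkip"

definition greedy_prog :: lprog where
  "greedy_prog = LFor 5 (LStore (Reg 5) (Const 1)) ;; LFor 8 step_prog"

definition main_prog :: lprog where
  "main_prog = next_prog ;; greedy_prog"

lemmas prog_defs = square_prog_def relax_prog_def round_prog_def init_prog_def next_prog_def
  walk_prog_def degree_prog_def step_prog_def greedy_prog_def main_prog_def

lemma wf_main_prog: "wf_lprog main_prog"
  by (simp add: prog_defs)

lemma square_prog_correct:
  assumes "fst s 0 = n" "fst s 1 = 0"
  shows "fst (den square_prog s) 1 = n * n"
  unfolding square_prog_def
  by (rule den_LFor_invariant[where I = "\<lambda>k s. fst s 1 = k * n" and n = n]) (use assms in auto)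

section \<open>Correctness of the Bellman-Ford phase\<close>

locale nat_graph = connected_pair_graph G for G :: "nat pair_pre_digraph" +
  fixes n :: nat
  assumes verts: "pverts G = {..<n}"
begin

definition is_next :: "nat \<Rightarrow> nat \<Rightarrow> nat \<Rightarrow> bool" where
  "is_next v x y \<longleftrightarrow>
     (if x = v then y = v else (x, y) \<in> parcs G \<and> Suc (gdist G y v) = gdist G x v)"

definition adj :: "(nat \<Rightarrow> nat) \<Rightarrow> bool" where
  "adj m \<longleftrightarrow> (\<forall>x<n. \<forall>y<n. m (x * n + y) \<noteq> 0 \<longleftrightarrow> (x, y) \<in> parcs G)"

definition table :: "nat \<Rightarrow> (nat \<Rightarrow> nat) \<Rightarrow> bool" where
  "table v m \<longleftrightarrow> (\<forall>v'<v. \<forall>x<n. is_next v' x (m (n * n + n + v' * n + x)))"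

abbreviation est :: "(nat \<Rightarrow> nat) \<Rightarrow> nat \<Rightarrow> nat" where
  "est m x \<equiv> m (n * n + x)"

abbreviation succ :: "nat \<Rightarrow> (nat \<Rightarrow> nat) \<Rightarrow> nat \<Rightarrow> nat" where
  "succ v m x \<equiv> m (n * n + n + v * n + x)"

text \<open>An estimate below \<open>n\<close> marks a vertex already reached. Along successors a
  strict descent is demanded rather than a difference of one, because the estimate of the successor
  may drop later.\<close>

definition relax_inv :: "nat \<Rightarrow> (nat \<Rightarrow> nat) \<Rightarrow> bool" where
  "relax_inv v m \<longleftrightarrow> adj m \<and> table v m \<and> est m v = 0 \<and> succ v m v = v \<and>
     (\<forall>x<n. gdist G x v \<le> est m x) \<and>
     (\<forall>x<n. x \<noteq> v \<longrightarrow> est m x < n \<longrightarrow> (x, succ v m x) \<in> parcs G \<and> est m (succ v m x) < est m x)"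

text \<open>Together with the lower bound on estimates in \<open>relax_inv\<close> this means
  equality within distance \<open>k\<close>, where \<open>k\<close> is the number of completed
  rounds.\<close>

definition exact :: "nat \<Rightarrow> nat \<Rightarrow> (nat \<Rightarrow> nat) \<Rightarrow> nat \<Rightarrow> bool" where
  "exact v k m x \<longleftrightarrow> (gdist G x v \<le> k \<longrightarrow> est m x \<le> gdist G x v)"

definition regs :: "nat \<Rightarrow> state \<Rightarrow> bool" where
  "regs v s \<longleftrightarrow> fst s 0 = n \<and> fst s 1 = n * n \<and> fst s 2 = v \<and> fst s 3 = n * n + n + v * n"

lemma arc_less: "(x, y) \<in> parcs G \<Longrightarrow> x < n \<and> y < n"
  using verts by (auto dest: wellformed')

lemma adj_update: "adj m \<Longrightarrow> n * n \<le> a \<Longrightarrow> adj (m(a := c))"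
  using row_less[of _ n _ n] by (fastforce simp: adj_def)

lemma table_update:
  assumes "table v m" "a < n * n + n \<or> n * n + n + v * n \<le> a"
  shows "table v (m(a := c))"
proof -
  have "n * n + n + v' * n + x \<noteq> a" if "v' < v" "x < n" for v' x
    using row_less[OF that] assms(2) by linarith
  with assms(1) show ?thesis by (simp add: table_def)
qed

text \<open>The new estimate of \<open>x\<close> still bounds its distance from above by
  \<open>gdist_arc_le\<close>, and \<open>x\<close> is not \<open>v\<close>, whose estimate is
  0.\<close>

lemma relax_inv_update:
  assumes inv: "relax_inv v m" and v: "v < n" and xy: "(x, y) \<in> parcs G"
    and less: "Suc (est m y) < est m x"
  defines "m' \<equiv> m(n * n + x := Suc (est m y), n * n + n + v * n + x := y)"
  shows "relax_inv v m'"
proof -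
  have x: "x < n" "y < n" using arc_less[OF xy] by auto
  have xv: "x \<noteq> v" using less inv by (auto simp: relax_inv_def)
  have neq: "x \<noteq> y" using less by auto
  have est': "est m' z = (if z = x then Suc (est m y) else est m z)" if "z < n" for z
    using that by (simp add: m'_def)
  have succ': "succ v m' z = (if z = x then y else succ v m z)" for z
    using x by (simp add: m'_def)
  have "adj m'" "table v m'"
    using inv x unfolding m'_def relax_inv_def by (auto intro!: adj_update table_update)
  moreover have "gdist G x v \<le> Suc (est m y)"
    using gdist_arc_le[OF xy, of v] inv x v verts unfolding relax_inv_def by fastforce
  moreover have "(z, succ v m' z) \<in> parcs G \<and> est m' (succ v m' z) < est m' z"
    if z: "z < n" "z \<noteq> v" "est m' z < n" for z
  proof (cases "z = x")
    case True
    with xy neq x show ?thesis by (simp add: est' succ')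
  next
    case False
    with z est' have e: "est m z < n" by simp
    then have a: "(z, succ v m z) \<in> parcs G" "est m (succ v m z) < est m z"
      using z inv by (auto simp: relax_inv_def)
    then have "succ v m z < n" using arc_less by blast
    \<comment> \<open>If the successor of \<open>z\<close> is \<open>x\<close>, the lowered estimate
      only makes the descent steeper.\<close>
    with a False z less show ?thesis by (auto simp: est' succ')
  qed
  ultimately show ?thesis
    using inv xv v x unfolding relax_inv_def by (simp add: est' succ')
qed

text \<open>Updates are made in place, so vertices before \<open>x\<close> have already completed
  round \<open>Suc k\<close>. Scanning the neighbours of \<open>x\<close> brings its estimate to at
  most one more than the distance of each neighbour within \<open>k\<close>.\<close>

lemma relax_prog_correct:
  assumes regs: "regs v s" "fst s 5 = x" "fst s 6 = x * n" and v: "v < n" and x: "x < n"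
    and inv: "relax_inv v (snd s)" "\<And>z. z < n \<Longrightarrow> exact v k (snd s) z"
      "\<And>z. z < x \<Longrightarrow> exact v (Suc k) (snd s) z"
  shows "relax_inv v (snd (den relax_prog s)) \<and>
    (\<forall>z<n. exact v k (snd (den relax_prog s)) z) \<and>
    (\<forall>z<Suc x. exact v (Suc k) (snd (den relax_prog s)) z)"
proof -
  define I where "I y s \<longleftrightarrow> regs v s \<and> fst s 5 = x \<and> fst s 6 = x * n \<and> relax_inv v (snd s) \<and>
    (\<forall>z<n. exact v k (snd s) z) \<and> (\<forall>z<x. exact v (Suc k) (snd s) z) \<and>
    (\<forall>y'<y. (x, y') \<in> parcs G \<longrightarrow> gdist G y' v \<le> k \<longrightarrow> est (snd s) x \<le> Suc (gdist G y' v))" for y s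
  have "I n (den relax_prog s)"
    unfolding relax_prog_def
  proof (rule den_LFor_invariant)
    show "I 0 (set_reg 7 0 s)" using assms by (auto simp: I_def regs_def)
  next
    fix y s
    assume y: "y < n" "fst s 0 = n" "fst s 7 = y" and I: "I y s"
    let ?m = "snd s"
    let ?B = "LCond (And (Mem (Add (Reg 6) (Reg 7)))
        (Sub (Mem (Add (Reg 1) (Reg 5))) (Add (Mem (Add (Reg 1) (Reg 7))) (Const 1))))
       (LStore (Add (Reg 1) (Reg 5)) (Add (Mem (Add (Reg 1) (Reg 7))) (Const 1)) ;;
        LStore (Add (Reg 3) (Reg 5)) (Reg 7))
       LSkip"
    have r: "fst s 1 = n * n" "fst s 3 = n * n + n + v * n" "fst s 5 = x" "fst s 6 = x * n"
      using I by (auto simp: I_def regs_def)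
    have arc: "?m (x * n + y) \<noteq> 0 \<longleftrightarrow> (x, y) \<in> parcs G"
      using I x y by (auto simp: I_def relax_inv_def adj_def)
    have ex: "gdist G y v \<le> k \<Longrightarrow> est ?m y \<le> gdist G y v"
      using I y by (auto simp: I_def exact_def)
    show "I (Suc y) (set_reg 7 (Suc y) (den ?B s))"
    proof (cases "(x, y) \<in> parcs G \<and> Suc (est ?m y) < est ?m x")
      case True
      let ?m' = "?m(n * n + x := Suc (est ?m y), n * n + n + v * n + x := y)"
      have den: "den ?B s = (fst s, ?m')"
        using True arc r y by simp
      have inv': "relax_inv v ?m'"
        using True I v by (intro relax_inv_update) (auto simp: I_def)
      have "est ?m' z \<le> est ?m z" if "z < n" for z
        using that True by simp
      then have "exact v j ?m z \<Longrightarrow> z < n \<Longrightarrow> exact v j ?m' z" for j z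
        unfolding exact_def by (meson order_trans)
      moreover have "est ?m' x = Suc (est ?m y)" using x by simp
      ultimately show ?thesis
        using I inv' True ex x unfolding den
        by (auto simp: I_def regs_def less_Suc_eq simp del: fun_upd_apply)
          (auto simp: fun_upd_def)
    next
      case False
      then have "den ?B s = s" using arc r y by auto
      with I False ex show ?thesis
        by (auto simp: I_def regs_def less_Suc_eq)
    qed
  qed (use regs in \<open>auto simp: regs_def\<close>)
  then have fin: "relax_inv v (snd (den relax_prog s))" "\<forall>z<n. exact v k (snd (den relax_prog s)) z"
    "\<forall>z<x. exact v (Suc k) (snd (den relax_prog s)) z"
    and nb: "\<And>y. (x, y) \<in> parcs G \<Longrightarrow> gdist G y v \<le> k \<Longrightarrow>
      est (snd (den relax_prog s)) x \<le> Suc (gdist G y v)"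
    using arc_less by (auto simp: I_def)
  have "exact v (Suc k) (snd (den relax_prog s)) x"
  proof (cases "x = v")
    case True
    with fin(1) show ?thesis by (simp add: exact_def relax_inv_def)
  next
    case False
    \<comment> \<open>If \<open>x\<close> lies within distance \<open>Suc k\<close>, this neighbour
      lies within \<open>k\<close>, so its exact estimate has been used.\<close>
    then obtain y where "(x, y) \<in> parcs G" "Suc (gdist G y v) = gdist G x v"
      using gdist_next[of x v] x v verts by auto
    with nb[of y] show ?thesis by (auto simp: exact_def)
  qed
  with fin show ?thesis by (simp add: less_Suc_eq)
qed

lemma regs_frame:
  assumes "regs v s" "assigned P \<inter> {0, 1, 2, 3} = {}"
  shows "regs v (den P s)"
  using assms by (auto simp: regs_def den_frame)

lemma round_prog_correct:
  assumes "regs v s" "v < n" "relax_inv v (snd s)" "\<And>z. z < n \<Longrightarrow> exact v k (snd s) z"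
  shows "relax_inv v (snd (den round_prog s)) \<and>
    (\<forall>z<n. exact v (Suc k) (snd (den round_prog s)) z)"
proof -
  define I where "I x s \<longleftrightarrow> regs v s \<and> fst s 6 = x * n \<and> relax_inv v (snd s) \<and>
    (\<forall>z<n. exact v k (snd s) z) \<and> (\<forall>z<x. exact v (Suc k) (snd s) z)" for x s
  let ?B = "relax_prog ;; LAssign 6 (Add (Reg 6) (Reg 0))"
  have "I n (den (LFor 5 ?B) (set_reg 6 0 s))"
  proof (rule den_LFor_invariant)
    show "I 0 (set_reg 5 0 (set_reg 6 0 s))" using assms by (auto simp: I_def regs_def)
  next
    fix x s
    assume x: "x < n" "fst s 0 = n" "fst s 5 = x" and I: "I x s"
    have "regs v (den relax_prog s)" "fst (den relax_prog s) 6 = fst s 6"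
      using I by (auto simp: I_def relax_prog_def den_frame intro!: regs_frame)
    with relax_prog_correct[of v s x k] I x \<open>v < n\<close>
    show "I (Suc x) (set_reg 5 (Suc x) (den ?B s))"
      by (simp add: I_def regs_def)
  qed (use assms in \<open>auto simp: regs_def relax_prog_def\<close>)
  then show ?thesis by (simp add: I_def round_prog_def)
qed

lemma init_prog_correct:
  assumes "regs v s" "v < n" "adj (snd s)" "table v (snd s)"
  shows "relax_inv v (snd (den init_prog s)) \<and> (\<forall>z<n. exact v 0 (snd (den init_prog s)) z)"
proof -
  define I where "I x s \<longleftrightarrow> regs v s \<and> adj (snd s) \<and> table v (snd s) \<and>
    (\<forall>z<x. est (snd s) z = n)" for x s
  let ?L = "LFor 5 (LStore (Add (Reg 1) (Reg 5)) (Reg 0))"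
  have "I n (den ?L s)"
  proof (rule den_LFor_invariant)
    show "I 0 (set_reg 5 0 s)" using assms by (auto simp: I_def regs_def)
  next
    fix x s
    assume x: "x < n" "fst s 0 = n" "fst s 5 = x" and I: "I x s"
    then have "adj ((snd s)(n * n + x := n))" "table v ((snd s)(n * n + x := n))"
      by (simp_all add: I_def adj_update table_update)
    with x I show "I (Suc x) (set_reg 5 (Suc x) (den (LStore (Add (Reg 1) (Reg 5)) (Reg 0)) s))"
      by (auto simp: I_def regs_def)
  qed (use assms in \<open>auto simp: regs_def\<close>)
  then have I: "regs v (den ?L s)" "adj (snd (den ?L s))" "table v (snd (den ?L s))"
    "\<And>z. z < n \<Longrightarrow> est (snd (den ?L s)) z = n"
    by (auto simp: I_def)
  define m where "m = snd (den init_prog s)"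
  have m: "m = (snd (den ?L s))(n * n + v := 0, n * n + n + v * n + v := v)"
    using I(1) by (simp add: m_def init_prog_def regs_def)
  have est: "est m z = (if z = v then 0 else n)" if "z < n" for z
    using that I(4) by (simp add: m)
  have "gdist G z v \<le> est m z" if "z < n" for z
    using that \<open>v < n\<close> gdist_less_card[of z v] verts est gdist_self[of v]
    by (simp add: less_imp_le)
  moreover have "exact v 0 m z" if "z < n" for z
    using that \<open>v < n\<close> est gdist_eq_0_iff[of z v] verts by (auto simp: exact_def)
  moreover have "adj m" "table v m"
    using I \<open>v < n\<close> by (auto simp: m intro!: adj_update table_update)
  moreover have "succ v m v = v" by (simp add: m)
  ultimately show ?thesis
    unfolding m_def[symmetric] relax_inv_def using est \<open>v < n\<close> by auto
qed

text \<open>After \<open>n\<close> rounds every estimate is the distance. The strict descent to the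
  successor and \<open>gdist_arc_le\<close> then leave a difference of exactly one.\<close>

lemma table_Suc:
  assumes inv: "relax_inv v m" and ex: "\<And>z. z < n \<Longrightarrow> exact v n m z" and v: "v < n"
  shows "table (Suc v) m"
proof -
  have est: "est m x = gdist G x v" if "x < n" for x
    using inv ex[OF that] that gdist_less_card[of x v] verts v
    by (auto simp: exact_def relax_inv_def intro: order_antisym)
  have "is_next v x (succ v m x)" if x: "x < n" for x
  proof (cases "x = v")
    case True
    with inv show ?thesis by (simp add: is_next_def relax_inv_def)
  next
    case False
    have "est m x < n" using est x gdist_less_card[of x v] verts v by simp
    with inv False x have a: "(x, succ v m x) \<in> parcs G" "est m (succ v m x) < est m x"
      by (auto simp: relax_inv_def)
    then show ?thesis
      using gdist_arc_le[OF a(1), of v] False est x arc_less[OF a(1)] v verts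
      by (simp add: is_next_def)
  qed
  with inv show ?thesis by (auto simp: relax_inv_def table_def less_Suc_eq)
qed

lemma next_prog_correct:
  assumes "fst s 0 = n" "fst s 1 = 0" "adj (snd s)"
  shows "table n (snd (den next_prog s))" "fst (den next_prog s) 1 = n * n"
proof -
  define I where "I v s \<longleftrightarrow> fst s 0 = n \<and> fst s 1 = n * n \<and> fst s 3 = n * n + n + v * n \<and>
    adj (snd s) \<and> table v (snd s)" for v and s :: state
  let ?B = "init_prog ;; LFor 4 round_prog ;; LAssign 3 (Add (Reg 3) (Reg 0))"
  let ?s = "set_reg 3 (n * n + n) (den square_prog s)"
  have sq: "fst (den square_prog s) 1 = n * n" "fst (den square_prog s) 0 = n"
    "snd (den square_prog s) = snd s"
    using square_prog_correct assms by (auto simp: square_prog_def den_frame den_no_store)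
  have "I n (den (LFor 2 ?B) ?s)"
  proof (rule den_LFor_invariant)
    show "I 0 (set_reg 2 0 ?s)" using assms sq by (auto simp: I_def table_def)
  next
    fix v s
    assume v: "v < n" "fst s 0 = n" "fst s 2 = v" and I: "I v s"
    define s1 where "s1 = den init_prog s"
    have R: "regs v s" using I v by (simp add: I_def regs_def)
    then have "regs v s1"
      unfolding s1_def by (rule regs_frame) (simp add: init_prog_def)
    have s1: "relax_inv v (snd s1)" "\<forall>z<n. exact v 0 (snd s1) z"
      using init_prog_correct[OF R] I v by (auto simp: s1_def I_def)
    define J where "J k s \<longleftrightarrow> regs v s \<and> relax_inv v (snd s) \<and> (\<forall>z<n. exact v k (snd s) z)" for k s
    have "J n (den (LFor 4 round_prog) s1)"
    proof (rule den_LFor_invariant)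
      show "J 0 (set_reg 4 0 s1)" using s1 \<open>regs v s1\<close> by (simp add: J_def regs_def)
    next
      fix k s
      assume "J k s"
      moreover from this have "regs v (den round_prog s)"
        by (intro regs_frame) (auto simp: J_def round_prog_def relax_prog_def)
      ultimately show "J (Suc k) (set_reg 4 (Suc k) (den round_prog s))"
        using round_prog_correct[of v s k] v by (simp add: J_def regs_def)
    qed (use \<open>regs v s1\<close> in \<open>auto simp: regs_def round_prog_def relax_prog_def\<close>)
    then have "regs v (den (LFor 4 round_prog) s1)" "adj (snd (den (LFor 4 round_prog) s1))"
      "table (Suc v) (snd (den (LFor 4 round_prog) s1))"
      using table_Suc v by (auto simp: J_def relax_inv_def)
    then show "I (Suc v) (set_reg 2 (Suc v) (den ?B s))"
      by (simp add: I_def regs_def s1_def)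
  qed (use sq in \<open>auto simp: prog_defs\<close>)
  then show "table n (snd (den next_prog s))" "fst (den next_prog s) 1 = n * n"
    using sq by (simp_all add: I_def next_prog_def)
qed

end

section \<open>Sum of distances and average distance\<close>

context nat_graph
begin

text \<open>Increasing and decreasing pairs contribute equally by symmetry, and the diagonal
  contributes 0.\<close>

lemma sum_gdist_eq_avg_dist:
  assumes "2 \<le> n"
  shows "(\<Sum>v<n. \<Sum>u<n. real (gdist G u v)) = real n * (real n - 1) * avg_dist G"
proof -
  let ?P = "{(u, v). u \<in> pverts G \<and> v \<in> pverts G \<and> u < v}"
  let ?Q = "{(u, v). u \<in> pverts G \<and> v \<in> pverts G \<and> v < u}"
  let ?d = "\<lambda>(u, v). real (gdist G u v)"
  have fin: "finite ?P" "finite ?Q"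
    by (auto simp: verts intro: finite_subset[of _ "{..<n} \<times> {..<n}"])
  have "(\<Sum>v<n. \<Sum>u<n. real (gdist G u v)) = (\<Sum>u<n. \<Sum>v<n. real (gdist G u v))"
    by (rule sum.swap)
  also have "\<dots> = sum ?d ({..<n} \<times> {..<n})"
    by (simp add: sum.cartesian_product)
  also have "\<dots> = sum ?d (?P \<union> ?Q)"
  proof (rule sum.mono_neutral_right)
    have "?d (u, v) = 0" if "(u, v) \<in> {..<n} \<times> {..<n} - (?P \<union> ?Q)" for u v
    proof -
      from that have "u = v" "v < n" by (auto simp: verts)
      then show ?thesis using gdist_self verts by simp
    qed
    then show "\<forall>e\<in>{..<n} \<times> {..<n} - (?P \<union> ?Q). ?d e = 0" by fastforce
  qed (auto simp: verts)
  also have "\<dots> = sum ?d ?P + sum ?d ?Q"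
    using fin by (intro sum.union_disjoint) auto
  also have "sum ?d ?Q = sum ?d ?P"
    by (rule sum.reindex_bij_witness[of _ prod.swap prod.swap]) (auto simp: gdist_commute)
  finally have "(\<Sum>v<n. \<Sum>u<n. real (gdist G u v)) = 2 * sum ?d ?P" by simp
  then show ?thesis
    using assms by (simp add: avg_dist_def verts)
qed

lemma avg_dist_ge_1:
  assumes "2 \<le> n"
  shows "1 \<le> avg_dist G"
proof -
  have "real n * (real n - 1) = (\<Sum>v<n. \<Sum>u<n. 1 - (if u = v then 1 else 0))"
    by (simp add: sum_subtractf)
  also have "\<dots> \<le> (\<Sum>v<n. \<Sum>u<n. real (gdist G u v))"
  proof (intro sum_mono)
    fix v u assume "v \<in> {..<n}" "u \<in> {..<n}"
    then have "u \<noteq> v \<Longrightarrow> 1 \<le> gdist G u v"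
      using gdist_eq_0_iff[of u v] verts by (simp add: Suc_le_eq)
    then show "1 - (if u = v then 1 else 0) \<le> real (gdist G u v)"
      by (cases "u = v") simp_all
  qed
  finally have "real n * (real n - 1) * 1 \<le> real n * (real n - 1) * avg_dist G"
    using sum_gdist_eq_avg_dist[OF assms] by simp
  then show ?thesis
    using assms by (simp add: mult_le_cancel_left_pos)
qed

end

section \<open>The hypergraph of blocking triples\<close>

locale nat_next_hop = nat_graph G n + next_hop G nx
  for G :: "nat pair_pre_digraph" and n :: nat and nx :: "nat \<Rightarrow> nat \<Rightarrow> nat"
begin

text \<open>A triple \<open>(v, u, j)\<close> stands for the vertex with index \<open>j + 1\<close> on the traced path from \<open>u\<close> to \<open>v\<close>.\<close>

definition blocking :: "(nat \<times> nat \<times> nat) set" where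
  "blocking = {(v, u, j). v < n \<and> u < n \<and> j < n \<and> hop v u (Suc j) \<noteq> v}"

definition triple :: "nat \<times> nat \<times> nat \<Rightarrow> nat set" where
  "triple e = (case e of (v, u, j) \<Rightarrow> {u, v, hop v u (Suc j)})"

lemma blocking_subset: "blocking \<subseteq> {..<n} \<times> {..<n} \<times> {..<n}"
  by (auto simp: blocking_def)

lemma hop_less: "u < n \<Longrightarrow> v < n \<Longrightarrow> hop v u i < n"
  using hop_in_verts verts by auto

text \<open>The traced path has not yet reached \<open>v\<close>, so its vertex
  \<open>hop v u (Suc j)\<close> is strictly closer to \<open>v\<close> than \<open>u\<close> is and
  differs from both.\<close>

lemma card_triple: "e \<in> blocking \<Longrightarrow> card (triple e) = 3"
proof (cases e)
  case (fields v u j)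
  assume "e \<in> blocking"
  with fields have e: "v \<in> pverts G" "u \<in> pverts G" "hop v u (Suc j) \<noteq> v"
    by (auto simp: blocking_def verts)
  then have "Suc j < gdist G u v"
    using hop_eq_target_iff[of u v "Suc j"] by simp
  then have "u \<noteq> v" "u \<noteq> hop v u (Suc j)"
    using gdist_self[of v] e gdist_hop[of u v "Suc j"] by auto
  with e fields show ?thesis by (simp add: triple_def)
qed

sublocale three_uniform blocking triple "{..<n}"
  using finite_subset[OF blocking_subset] card_triple by unfold_locales auto

text \<open>A position \<open>Suc j\<close> is inner only if it is below \<open>gdist G u v\<close>.
  This is where the distances enter the number of edges.\<close>

lemma card_blocking_le: "card blocking \<le> (\<Sum>v<n. \<Sum>u<n. gdist G u v)"
proof -
  have "card blocking \<le> card (SIGMA v:{..<n}. SIGMA u:{..<n}. {..<gdist G u v})"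
  proof (rule card_mono)
    show "blocking \<subseteq> (SIGMA v:{..<n}. SIGMA u:{..<n}. {..<gdist G u v})"
      using hop_eq_target_iff by (fastforce simp: blocking_def verts)
  qed auto
  then show ?thesis by simp
qed

lemma induced_blocking_iff:
  "(v, u, j) \<in> ind X \<longleftrightarrow> v < n \<and> u < n \<and> j < n \<and> hop v u (Suc j) \<noteq> v \<and>
     u \<in> X \<and> v \<in> X \<and> hop v u (Suc j) \<in> X"
  by (auto simp: induced_def blocking_def triple_def)

lemma mutual_visibility_if_no_blocking:
  assumes "X \<subseteq> {..<n}" "ind X = {}"
  shows "mutual_visibility_set G X"
  unfolding mutual_visibility_set_def
proof (intro conjI ballI impI)
  fix u v assume uv: "u \<in> X" "v \<in> X"
  then have l: "u < n" "v < n" using assms by auto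
  show "visible G X u v"
  proof (rule visible_hop)
    fix i assume h: "hop v u (Suc i) \<noteq> v"
    \<comment> \<open>The walk has arrived after fewer than \<open>n\<close> hops, so the range of
      \<open>j\<close> in \<open>blocking\<close> covers all inner positions.\<close>
    then have "i < n"
      using hop_eq_target_iff[of u v "Suc i"] gdist_less_card[of u v] l verts by simp
    with h l uv assms(2) show "hop v u (Suc i) \<notin> X"
      using induced_blocking_iff[of v u i X] by blast
  qed (use l verts in auto)
qed (use assms verts in auto)

section \<open>Degrees and deletions computed by the program\<close>

definition hit :: "nat set \<Rightarrow> nat \<Rightarrow> nat \<Rightarrow> nat \<Rightarrow> nat \<Rightarrow> nat" where
  "hit X w v u j = (if (v, u, j) \<in> ind X \<and> w \<in> triple (v, u, j) then 1 else 0)"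

text \<open>The triple sum has the shape of the nested loops in \<open>degree_prog\<close>.\<close>

lemma hdeg_eq_sum_hit: "deg X w = (\<Sum>v<n. \<Sum>u<n. \<Sum>j<n. hit X w v u j)"
proof -
  have "{e \<in> ind X. w \<in> triple e} =
      {e \<in> {..<n} \<times> {..<n} \<times> {..<n}. e \<in> ind X \<and> w \<in> triple e}"
    using blocking_subset by (auto simp: induced_def)
  then have "deg X w = (\<Sum>e\<in>{..<n} \<times> {..<n} \<times> {..<n}. if e \<in> ind X \<and> w \<in> triple e then 1 else 0)"
    by (simp add: hdeg_def flip: sum.inter_filter)
  then show ?thesis
    by (simp add: hit_def sum.cartesian_product case_prod_unfold)
qed

definition mem_ok :: "nat set \<Rightarrow> (nat \<Rightarrow> nat) \<Rightarrow> bool" where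
  "mem_ok X m \<longleftrightarrow> (\<forall>w<n. m w = (if w \<in> X then 1 else 0)) \<and>
     (\<forall>v<n. \<forall>u<n. m (n * n + n + v * n + u) = nx v u)"

lemma val_hit_expr:
  assumes "fst s 2 = v" "fst s 7 = u" "fst s 11 = w" "fst s 5 = hop v u (Suc j)"
    and l: "v < n" "u < n" "j < n" and "mem_ok X (snd s)"
  shows "val hit_expr s = hit X w v u j"
proof -
  have X: "snd s z \<noteq> 0 \<longleftrightarrow> z \<in> X" if "z < n" for z
    using assms that by (simp add: mem_ok_def)
  note X = X[OF l(1)] X[OF l(2)] X[OF hop_less[OF l(2,1), of "Suc j"]]
  have "val hit_expr s = (if (u \<in> X \<and> v \<in> X \<and> hop v u (Suc j) \<in> X) \<and>
      (hop v u (Suc j) \<noteq> v \<and> (w = u \<or> w = v \<or> w = hop v u (Suc j))) then 1 else 0)"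
    unfolding hit_expr_def val_And val.simps val_Eq
    using assms(1-4) X by simp
  then show ?thesis
    using l by (simp add: hit_def induced_blocking_iff triple_def)
qed

lemma walk_prog_correct:
  assumes "regs v s" "fst s 7 = u" "fst s 11 = w" "v < n" "u < n" "mem_ok X (snd s)"
  shows "fst (den walk_prog s) 12 = fst s 12 + (\<Sum>j<n. hit X w v u j)"
proof -
  define I where "I i s' \<longleftrightarrow> regs v s' \<and> fst s' 7 = u \<and> fst s' 11 = w \<and> snd s' = snd s \<and>
    fst s' 5 = hop v u i \<and> fst s' 12 = fst s 12 + (\<Sum>j<i. hit X w v u j)" for i and s' :: state
  have "I n (den walk_prog s)"
    unfolding walk_prog_def den.simps(4)
  proof (rule den_LFor_invariant)
    show "I 0 (set_reg 4 0 (den (LAssign 5 (Reg 7)) s))"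
      using assms by (simp add: I_def regs_def)
  next
    fix i s'
    assume i: "i < n" "fst s' 0 = n" "fst s' 4 = i" and I: "I i s'"
    have l: "hop v u i < n" "hop v u (Suc i) < n" using hop_less assms by auto
    have nx: "snd s (n * n + n + v * n + hop v u i) = hop v u (Suc i)"
      using assms l by (simp add: mem_ok_def hop_Suc)
    \<comment> \<open>Register 5 advances before the test, so round \<open>i\<close> examines
      position \<open>Suc i\<close>.\<close>
    define t where "t = den (LAssign 5 (Mem (Add (Reg 3) (Reg 5)))) s'"
    have t: "regs v t" "fst t 7 = u" "fst t 11 = w" "snd t = snd s" "fst t 5 = hop v u (Suc i)"
      "fst t 12 = fst s' 12"
      using I nx by (simp_all add: t_def I_def regs_def)
    then have "val hit_expr t = hit X w v u i"
      using i assms by (intro val_hit_expr) (auto simp: regs_def)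
    with t I show "I (Suc i) (set_reg 4 (Suc i) (den (LAssign 5 (Mem (Add (Reg 3) (Reg 5))) ;;
        LAssign 12 (Add (Reg 12) hit_expr)) s'))"
      unfolding den.simps(4) t_def[symmetric] by (simp add: I_def regs_def)
  qed (use assms in \<open>auto simp: regs_def\<close>)
  then show ?thesis by (simp add: I_def)
qed

lemma degree_prog_correct:
  assumes "fst s 0 = n" "fst s 1 = n * n" "fst s 11 = w" "mem_ok X (snd s)"
  shows "fst (den degree_prog s) 12 = deg X w"
proof -
  define I where "I v s' \<longleftrightarrow> fst s' 0 = n \<and> fst s' 1 = n * n \<and> fst s' 3 = n * n + n + v * n \<and>
    fst s' 11 = w \<and> snd s' = snd s \<and>
    fst s' 12 = (\<Sum>v'<v. \<Sum>u<n. \<Sum>j<n. hit X w v' u j)" for v and s' :: state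
  have "I n (den degree_prog s)"
    unfolding degree_prog_def den.simps(4)
  proof (rule den_LFor_invariant)
    show "I 0 (set_reg 2 0 (den (LAssign 3 (Add (Reg 1) (Reg 0))) (den (LAssign 12 (Const 0)) s)))"
      using assms by (simp add: I_def)
  next
    fix v s'
    assume v: "v < n" "fst s' 0 = n" "fst s' 2 = v" and I: "I v s'"
    define J where "J u t \<longleftrightarrow> regs v t \<and> fst t 11 = w \<and> snd t = snd s \<and>
      fst t 12 = fst s' 12 + (\<Sum>u'<u. \<Sum>j<n. hit X w v u' j)" for u and t :: state
    have "J n (den (LFor 7 walk_prog) s')"
    proof (rule den_LFor_invariant)
      show "J 0 (set_reg 7 0 s')" using I v by (simp add: I_def J_def regs_def)
    next
      fix u t
      assume u: "u < n" "fst t 7 = u" and J: "J u t"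
      then have "regs v (den walk_prog t)"
        by (intro regs_frame) (auto simp: J_def walk_prog_def)
      moreover have "fst (den walk_prog t) 11 = w" "snd (den walk_prog t) = snd s"
        using J by (simp_all add: J_def walk_prog_def den_frame den_no_store)
      moreover have "fst (den walk_prog t) 12 = fst t 12 + (\<Sum>j<n. hit X w v u j)"
        using walk_prog_correct[of v t u w X] J u v assms(4) by (simp add: J_def)
      ultimately show "J (Suc u) (set_reg 7 (Suc u) (den walk_prog t))"
        using J by (simp add: J_def regs_def)
    qed (use v in \<open>auto simp: walk_prog_def\<close>)
    with I show "I (Suc v) (set_reg 2 (Suc v)
        (den (LFor 7 walk_prog ;; LAssign 3 (Add (Reg 3) (Reg 0))) s'))"
      by (simp add: I_def J_def regs_def)
  qed (use assms in \<open>auto simp: walk_prog_def\<close>)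
  then show ?thesis by (simp add: I_def hdeg_eq_sum_hit)
qed

lemma hdeg_pos_iff: "0 < deg X w \<longleftrightarrow> (\<exists>e\<in>ind X. w \<in> triple e)"
  by (auto simp: hdeg_def card_gt_0_iff)

text \<open>The program maximises over all vertices, \<open>greedy_step\<close> only over
  \<open>X\<close>. A positive maximum is attained inside \<open>X\<close>, as every other vertex
  has degree 0.\<close>

lemma step_prog_correct:
  assumes "fst s 0 = n" "fst s 1 = n * n" "mem_ok X (snd s)" "X \<subseteq> {..<n}"
  shows "\<exists>Y. step X Y \<and> mem_ok Y (snd (den step_prog s))"
proof -
  define I where "I w s' \<longleftrightarrow> fst s' 0 = n \<and> fst s' 1 = n * n \<and> snd s' = snd s \<and>
    (\<forall>w'<w. deg X w' \<le> fst s' 9) \<and>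
    (0 < fst s' 9 \<longrightarrow> fst s' 10 < n \<and> deg X (fst s' 10) = fst s' 9)" for w and s' :: state
  let ?B = "degree_prog ;;
       LCond (Sub (Reg 12) (Reg 9)) (LAssign 9 (Reg 12) ;; LAssign 10 (Reg 11)) LSkip"
  define t where "t = den (LFor 11 ?B) (set_reg 10 0 (set_reg 9 0 s))"
  have "I n t"
    unfolding t_def
  proof (rule den_LFor_invariant)
    show "I 0 (set_reg 11 0 (set_reg 10 0 (set_reg 9 0 s)))"
      using assms by (simp add: I_def)
  next
    fix w s'
    assume w: "w < n" "fst s' 11 = w" and I: "I w s'"
    define s1 where "s1 = den degree_prog s'"
    have "fst s1 12 = deg X w"
      using degree_prog_correct[of s' w X] I w assms by (simp add: I_def s1_def)
    moreover have "fst s1 r = fst s' r" if "r \<in> {0, 1, 9, 10, 11}" for r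
      using that unfolding s1_def
      by (intro den_frame) (auto simp: degree_prog_def walk_prog_def)
    moreover have "snd s1 = snd s'"
      unfolding s1_def by (rule den_no_store) (simp add: degree_prog_def walk_prog_def)
    ultimately show "I (Suc w) (set_reg 11 (Suc w) (den ?B s'))"
      using I w by (auto simp: I_def less_Suc_eq simp flip: s1_def)
  qed (use assms in \<open>auto simp: degree_prog_def walk_prog_def\<close>)
  then have t: "snd t = snd s" "\<And>w. w < n \<Longrightarrow> deg X w \<le> fst t 9"
    "0 < fst t 9 \<Longrightarrow> fst t 10 < n \<and> deg X (fst t 10) = fst t 9"
    by (auto simp: I_def)
  have den: "den step_prog s = (if fst t 9 \<noteq> 0 then (fst t, (snd t)(fst t 10 := 0)) else t)"
    by (simp add: step_prog_def t_def)
  show ?thesis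
  proof (cases "fst t 9 = 0")
    case True
    have "ind X = {}"
    proof (rule ccontr)
      assume "ind X \<noteq> {}"
      then obtain v u j where e: "(v, u, j) \<in> ind X" by auto
      then have "v < n" "0 < deg X v"
        by (auto simp: induced_blocking_iff hdeg_pos_iff triple_def intro!: bexI[of _ "(v, u, j)"])
      with t(2)[of v] True show False by simp
    qed
    with True assms(3) t(1) den show ?thesis by (auto simp: greedy_step_def)
  next
    case False
    define w where "w = fst t 10"
    have w: "w < n" "deg X w = fst t 9" using t(3) False by (auto simp: w_def)
    then obtain e where "e \<in> ind X" "w \<in> triple e" using False hdeg_pos_iff[of X w] by auto
    then have "w \<in> X" "ind X \<noteq> {}" unfolding induced_def by blast+
    then have "step X (X - {w})"
      using t(2) w assms(4) by (auto simp: greedy_step_def intro!: bexI[of _ w])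
    moreover have "mem_ok (X - {w}) ((snd s)(w := 0))"
      using assms(3) w(1) by (auto simp: mem_ok_def)
    ultimately show ?thesis using False t(1) den by (auto simp: w_def)
  qed
qed

lemma greedy_prog_correct:
  assumes "fst s 0 = n" "fst s 1 = n * n"
    "\<And>v u. v < n \<Longrightarrow> u < n \<Longrightarrow> snd s (n * n + n + v * n + u) = nx v u"
  shows "\<exists>X. (step ^^ n) {..<n} X \<and> output_set n (den greedy_prog s) = X"
proof -
  define I where "I k s' \<longleftrightarrow> fst s' 0 = n \<and> fst s' 1 = n * n \<and> (\<forall>w<k. snd s' w = 1) \<and>
    (\<forall>v<n. \<forall>u<n. snd s' (n * n + n + v * n + u) = nx v u)" for k and s' :: state
  define s1 where "s1 = den (LFor 5 (LStore (Reg 5) (Const 1))) s"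
  have "I n s1"
    unfolding s1_def
  proof (rule den_LFor_invariant)
    show "I 0 (set_reg 5 0 s)" using assms by (simp add: I_def)
  next
    fix k s'
    assume "k < n" "fst s' 0 = n" "fst s' 5 = k" "I k s'"
    then show "I (Suc k) (set_reg 5 (Suc k) (den (LStore (Reg 5) (Const 1)) s'))"
      by (auto simp: I_def)
  qed (use assms in auto)
  define J where "J k s' \<longleftrightarrow> fst s' 0 = n \<and> fst s' 1 = n * n \<and>
    (\<exists>X. (step ^^ k) {..<n} X \<and> mem_ok X (snd s'))" for k and s' :: state
  have "J n (den (LFor 8 step_prog) s1)"
  proof (rule den_LFor_invariant)
    show "J 0 (set_reg 8 0 s1)" using \<open>I n s1\<close> by (simp add: I_def J_def mem_ok_def)
  next
    fix k s'
    assume J: "J k s'"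
    then obtain X where X: "(step ^^ k) {..<n} X" "mem_ok X (snd s')" by (auto simp: J_def)
    with step_prog_correct[of s' X] greedy_subset[OF X(1)] J obtain Y where
      "step X Y" "mem_ok Y (snd (den step_prog s'))" by (auto simp: J_def)
    moreover have "fst (den step_prog s') r = fst s' r" if "r \<in> {0, 1}" for r
      using that by (intro den_frame) (auto simp: step_prog_def degree_prog_def walk_prog_def)
    ultimately show "J (Suc k) (set_reg 8 (Suc k) (den step_prog s'))"
      using J X by (auto simp: J_def)
  qed (use \<open>I n s1\<close> in \<open>auto simp: I_def step_prog_def degree_prog_def walk_prog_def\<close>)
  then obtain X where X: "(step ^^ n) {..<n} X" "mem_ok X (snd (den greedy_prog s))"
    by (auto simp: J_def greedy_prog_def s1_def)
  moreover from this have "output_set n (den greedy_prog s) = X"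
    using greedy_subset[OF X(1)] by (auto simp: output_set_def mem_ok_def split: if_splits)
  ultimately show ?thesis by blast
qed

section \<open>Size of the resulting set\<close>

lemma greedy_card_ge:
  assumes "2 \<le> n" "(step ^^ n) {..<n} X"
  shows "1 / 6 * sqrt (real n / avg_dist G) \<le> card X"
proof -
  define D where "D = avg_dist G"
  \<comment> \<open>The factor 1/3 gives \<open>D * J\<^sup>2 = n / 9\<close>, so that 8 times the
    edge bound times \<open>J\<^sup>2\<close> is at most 8/9 of \<open>n ^ 3\<close>, as
    \<open>greedy_size\<close> demands.\<close>
  define J where "J = sqrt (real n / D) / 3"
  have D: "1 \<le> D" using avg_dist_ge_1[OF assms(1)] by (simp add: D_def)
  have J2: "J\<^sup>2 = real n / (9 * D)"
    using D by (simp add: J_def power_divide)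
  have "J / 2 \<le> card X"
  proof (cases "1 \<le> J")
    case True
    have "real n / D \<le> real n" using D by (simp add: divide_le_eq mult_le_cancel_left1)
    also have "\<dots> \<le> (real n)\<^sup>2" using assms(1) by (simp add: power2_eq_square)
    finally have "sqrt (real n / D) \<le> real n" by (simp add: real_le_lsqrt)
    then have "J \<le> n" by (simp add: J_def)
    have "real (card blocking) \<le> real (\<Sum>v<n. \<Sum>u<n. gdist G u v)"
      using card_blocking_le by (rule of_nat_mono)
    also have "\<dots> = real n * (real n - 1) * D"
      using sum_gdist_eq_avg_dist[OF assms(1)] by (simp add: D_def)
    also have "\<dots> \<le> (real n)\<^sup>2 * D"
      using D by (intro mult_right_mono) (auto simp: power2_eq_square algebra_simps)
    finally have "8 * real (card blocking) * J\<^sup>2 \<le> 8 * ((real n)\<^sup>2 * D) * J\<^sup>2"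
      by (intro mult_right_mono) auto
    also have "\<dots> = 8 * (real n)\<^sup>2 * (D * J\<^sup>2)" by simp
    also have "D * J\<^sup>2 = real n / 9" using D by (simp add: J2)
    also have "8 * (real n)\<^sup>2 * (real n / 9) = 8 / 9 * real n ^ 3"
      by (simp add: power2_eq_square power3_eq_cube)
    also have "\<dots> \<le> real n ^ 3" by simp
    finally have "8 * real (card blocking) * J\<^sup>2 \<le> real n ^ 3" .
    \<comment> \<open>Both alternatives of \<open>greedy_size\<close> imply
      \<open>J / 2 \<le> card X\<close>; halving \<open>J\<close> turns 1/3 into the final
      1/6.\<close>
    with greedy_size[of J n X] True \<open>J \<le> n\<close> assms(2) show ?thesis by auto
  next
    case False
    \<comment> \<open>For \<open>J < 1\<close> a single remaining vertex is enough.\<close>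
    have "{..<n} \<noteq> {}" using assms(1) by (auto simp: lessThan_empty_iff)
    then have "finite X" "X \<noteq> {}"
      using greedy_subset[OF assms(2)] greedy_nonempty[OF _ assms(2)] finite_subset by auto
    then have "1 \<le> card X" by (simp add: Suc_le_eq card_gt_0_iff)
    with False show ?thesis by linarith
  qed
  then show ?thesis by (simp add: J_def D_def)
qed

end

section \<open>The two phases combined\<close>

context nat_graph
begin

lemma main_prog_correct:
  defines "X \<equiv> output_set n (den main_prog (input_state n G))"
  shows "mutual_visibility_set G X"
    and "2 \<le> n \<Longrightarrow> 1 / 6 * sqrt (real n / avg_dist G) \<le> card X"
proof -
  let ?s = "input_state n G"
  have "adj (snd ?s)"
    unfolding adj_def
  proof (intro allI impI)
    fix x y assume "x < n" "y < n"
    then show "snd ?s (x * n + y) \<noteq> 0 \<longleftrightarrow> (x, y) \<in> parcs G"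
      using row_less[of x n y n] by (simp add: input_state_def)
  qed
  define t where "t = den next_prog ?s"
  have "fst t 0 = fst ?s 0"
    unfolding t_def using wf_main_prog
    by (intro den_frame zero_not_assigned) (simp add: main_prog_def)
  then have t: "table n (snd t)" "fst t 1 = n * n" "fst t 0 = n"
    using next_prog_correct[of ?s] \<open>adj (snd ?s)\<close> by (auto simp: t_def input_state_def)
  \<comment> \<open>The hop function, and with it the hypergraph, is read off the memory left by the
    first phase.\<close>
  define nx where "nx = (\<lambda>v u. snd t (n * n + n + v * n + u))"
  have nx: "is_next v u (nx v u)" if "v < n" "u < n" for v u
    using t(1) that by (simp add: table_def nx_def)
  interpret nat_next_hop G n nx
  proof unfold_locales
    fix u v
    assume v: "v \<in> pverts G"
    then show "nx v v = v" using nx[of v v] by (simp add: verts is_next_def)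
    assume "u \<in> pverts G" "u \<noteq> v"
    then show "(u, nx v u) \<in> parcs G" "Suc (gdist G (nx v u) v) = gdist G u v"
      using nx[of v u] v by (auto simp: verts is_next_def)
  qed
  have "output_set n (den greedy_prog t) = X"
    by (simp add: X_def main_prog_def t_def)
  with greedy_prog_correct[of t] t have X: "(step ^^ n) {..<n} X"
    by (auto simp: nx_def)
  with greedy_terminates[of X] greedy_subset[OF X] show "mutual_visibility_set G X"
    by (intro mutual_visibility_if_no_blocking) auto
  show "1 / 6 * sqrt (real n / avg_dist G) \<le> card X" if "2 \<le> n"
    using greedy_card_ge[OF that X] .
qed

end

theorem theorem1:
  shows "\<exists>(P :: prog) (p :: nat poly) (c :: real). c > 0 \<and>
    (\<forall>(n :: nat) (G :: nat pair_pre_digraph).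
       pair_graph G \<and> Digraph_Component.connected (with_proj G) \<and> pverts G = {..<n} \<longrightarrow>
       (\<exists>t s. exec P (input_state n G) t s \<and> t \<le> poly p n \<and>
          mutual_visibility_set G (output_set n s) \<and>
          (n \<ge> 2 \<longrightarrow> real (card (output_set n s)) \<ge> c * sqrt (real n / avg_dist G))))"
proof (intro exI[of _ "compile main_prog"] exI[of _ "time main_prog"] exI[of _ "1 / 6"]
    conjI allI impI)
  fix n :: nat and G :: "nat pair_pre_digraph"
  assume G: "pair_graph G \<and> Digraph_Component.connected (with_proj G) \<and> pverts G = {..<n}"
  then interpret nat_graph G n
    by (auto simp: nat_graph_def nat_graph_axioms_def connected_pair_graph_def
        connected_pair_graph_axioms_def)
  obtain t where "exec (compile main_prog) (input_state n G) t (den main_prog (input_state n G))"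
    "t \<le> poly (time main_prog) (fst (input_state n G) 0)"
    using exec_compile[OF wf_main_prog] by blast
  moreover have "fst (input_state n G) 0 = n" by (simp add: input_state_def)
  ultimately show "\<exists>t s. exec (compile main_prog) (input_state n G) t s \<and> t \<le> poly (time main_prog) n \<and>
      mutual_visibility_set G (output_set n s) \<and>
      (n \<ge> 2 \<longrightarrow> real (card (output_set n s)) \<ge> 1 / 6 * sqrt (real n / avg_dist G))"
    using main_prog_correct by metis
qed simp

end
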